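(* For every composition $\gamma$, $$\triangle G_\gamma(q)=\sum_{(\alpha,\beta)}\ \sum_{\beta'\preceq\beta}q^{g(\beta,\beta')}\,d(\alpha;\beta,\beta';\gamma)\,G_\alpha(q)\otimes G_{\beta'}(q),$$ where the outer sum is over all pairs $(\alpha,\beta)$ of (possibly empty) compositions with $\alpha\cdot\beta=\gamma$ or $\alpha\odot\beta=\gamma$, and $$d(\alpha;\beta,\beta';\gamma)=\begin{cases}c_q(\ell(\alpha),\ell(\beta')-\ell(\beta))&\text{if }\alpha\cdot\beta=\gamma,\\ c_q(\ell(\alpha),\ell(\beta')-\ell(\beta)+1)&\text{otherwise.}\end{cases}$$
   Context: Notation: $[k]=\{1,\dots,k\}$ for $k\ge1$ and $[k]=\emptyset$ for $k\le 0$. A composition is a finite (possibly empty) tuple of positive integers; $\ell(\alpha)$ is its length. For a composition $\alpha=(\alpha_1,\dots,\alpha_l)$ of $n$, $\mathrm{set}(\alpha)=\{\alpha_1,\alpha_1+\alpha_2,\dots,\alpha_1+\dots+\alpha_{l-1}\}\subseteq[n-1]$. $\beta'\preceq\beta$ means that $\beta'$ refines $\beta$, i.e. both have the same size and $\mathrm{set}(\beta)\subseteq\mathrm{set}(\beta')$. $\alpha\cdot\beta$ is concatenation; $\alpha\odot\beta=(\alpha_1,\dots,\alpha_{l-1},\alpha_l+\beta_1,\beta_2,\dots,\beta_k)$ is near-concatenation for nonempty $\alpha,\beta$, with $\alpha\odot\emptyset=\alpha$, $\emptyset\odot\beta=\beta$. $M_\alpha=\sum_{i_1<\dots<i_l}x_{i_1}^{\alpha_1}\cdots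 x_{i_l}^{\alpha_l}$, $\triangle M_\alpha=\sum_{\beta\cdot\gamma=\alpha}M_\beta\otimes M_\gamma$, and $L_\alpha=\sum_{\beta\preceq\alpha}M_\beta$. Hivert's quasisymmetric Hall--Littlewood function in $\mathrm{QSym}_{\mathbb C(q)}$ is given, for $I=\mathrm{set}(\alpha)$, by $$G_\alpha(q)=\sum_{\beta\preceq\alpha}(-1)^{\ell(\beta)-\ell(\alpha)}q^{s}L_\beta,\qquad s=\sum_{i\in\mathrm{set}(\beta)\setminus I}\mathrm{wt}_I(i),\quad \mathrm{wt}_I(i)=|[1,i-1]\cap I|+1$$ (with $G_\emptyset(q)=1$). For $\beta'\preceq\beta$ with $\mathrm{set}(\beta')=\{j_1<\dots<j_r\}$, $g(\beta,\beta')=\sum_{k\in[r]:\,j_k\notin\mathrm{set}(\beta)}k$. For nonnegative integers $u,v$: $c_q(u,v)=(1-q^u)(1-q^{u-1})\cdots(1-q^{u-v+1})$, with $c_q(u,0)=1$ and $c_q(u,v)=0$ if $v>u$. *)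

theory Defs
  imports
    Complex_Main
    "HOL-Library.Poly_Mapping"
    "HOL-Computational_Algebra.Polynomial"
    "HOL-Computational_Algebra.Fraction_Field"
begin

section \<open>Compositions\<close>

definition is_composition :: "nat list \<Rightarrow> bool" where
  "is_composition \<alpha> \<longleftrightarrow> (\<forall>a\<in>set \<alpha>. 0 < a)"

definition comp_set :: "nat list \<Rightarrow> nat set" where
  "comp_set \<alpha> = (\<lambda>k. sum_list (take k \<alpha>)) ` {1..<length \<alpha>}"

definition refines :: "nat list \<Rightarrow> nat list \<Rightarrow> bool" (infix \<open>\<preceq>\<close> 50) where
  "\<beta> \<preceq> \<alpha> \<longleftrightarrow> is_composition \<beta> \<and> is_composition \<alpha> \<and>
     sum_list \<beta> = sum_list \<alpha> \<and> comp_set \<alpha> \<subseteq> comp_set \<beta>"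

fun near_concat :: "nat list \<Rightarrow> nat list \<Rightarrow> nat list" (infixr \<open>\<odot>\<close> 65) where
  "[] \<odot> \<beta> = \<beta>"
| "\<alpha> \<odot> [] = \<alpha>"
| "(a # \<alpha>) \<odot> (b # \<beta>) = butlast (a # \<alpha>) @ (last (a # \<alpha>) + b) # \<beta>"

section \<open>Quasisymmetric functions over the field of rational functions\<close>

type_synonym ratfun = "complex poly fract"

definition q :: ratfun where
  "q = Fract [:0, 1:] 1"

text \<open>
  A power series in countably many commuting variables is given by its coefficient function on
  exponent vectors. The variables are indexed by all natural numbers, starting from zero;
  only the order of the indices matters.
\<close>

type_synonym exponents = "nat \<Rightarrow>\<^sub>0 nat"

definition exps :: "nat list \<Rightarrow> nat list \<Rightarrow> exponents" where
  \<comment> \<open>the monomial \<open>x\<^bsub>is ! 0\<^esub>^(\<alpha> ! 0) * x\<^bsub>is ! 1\<^esub>^(\<alpha> ! 1) * \<dots>\<close>\<close>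
  "exps is \<alpha> = (\<Sum>k<length \<alpha>. Poly_Mapping.single (is ! k) (\<alpha> ! k))"

definition total_degree :: "exponents \<Rightarrow> nat" where
  "total_degree m = (\<Sum>i\<in>Poly_Mapping.keys m. Poly_Mapping.lookup m i)"

definition bounded_degree :: "(exponents \<Rightarrow> ratfun) \<Rightarrow> bool" where
  "bounded_degree f \<longleftrightarrow> (\<exists>d. \<forall>m. f m \<noteq> 0 \<longrightarrow> total_degree m \<le> d)"

definition quasisymmetric :: "(exponents \<Rightarrow> ratfun) \<Rightarrow> bool" where
  "quasisymmetric f \<longleftrightarrow> (\<forall>\<alpha> is js. is_composition \<alpha> \<longrightarrow>
     length is = length \<alpha> \<longrightarrow> length js = length \<alpha> \<longrightarrow>
     sorted_wrt (<) is \<longrightarrow> sorted_wrt (<) js \<longrightarrow> f (exps is \<alpha>) = f (exps js \<alpha>))"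

text \<open>
  The coefficient field and the exponent vectors are themselves lifted types; without the
  following, lifting to the type of quasisymmetric functions would unfold them as well.
\<close>

lifting_forget fract.lifting
lifting_forget poly.lifting
lifting_forget poly_mapping.lifting

typedef qsym = "{f. bounded_degree f \<and> quasisymmetric f}"
  morphisms coeff_qsym Abs_qsym
  by (rule exI [of _ "\<lambda>_. 0"]) (simp add: bounded_degree_def quasisymmetric_def)

setup_lifting type_definition_qsym

lemma bounded_degree_add:
  assumes "bounded_degree f" "bounded_degree g"
  shows "bounded_degree (\<lambda>m. f m + g m)"
proof -
  obtain d e where "\<forall>m. f m \<noteq> 0 \<longrightarrow> total_degree m \<le> d" "\<forall>m. g m \<noteq> 0 \<longrightarrow> total_degree m \<le> e"
    using assms unfolding bounded_degree_def by blast
  then have "\<forall>m. f m + g m \<noteq> 0 \<longrightarrow> total_degree m \<le> max d e"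
    by (metis add.right_neutral max.coboundedI1 max.coboundedI2)
  then show ?thesis unfolding bounded_degree_def by blast
qed

lemma bounded_degree_mult: "bounded_degree f \<Longrightarrow> bounded_degree (\<lambda>m. c * f m)"
  unfolding bounded_degree_def by (metis mult_zero_right)

lemma quasisymmetric_add:
  "quasisymmetric f \<Longrightarrow> quasisymmetric g \<Longrightarrow> quasisymmetric (\<lambda>m. f m + g m)"
  unfolding quasisymmetric_def by metis

lemma quasisymmetric_mult: "quasisymmetric f \<Longrightarrow> quasisymmetric (\<lambda>m. c * f m)"
  unfolding quasisymmetric_def by metis

instantiation qsym :: ab_group_add
begin

lift_definition zero_qsym :: qsym is "\<lambda>_. 0"
  by (simp add: bounded_degree_def quasisymmetric_def)

lift_definition plus_qsym :: "qsym \<Rightarrow> qsym \<Rightarrow> qsym" is "\<lambda>f g m. f m + g m"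
  by (simp add: bounded_degree_add quasisymmetric_add)

lift_definition uminus_qsym :: "qsym \<Rightarrow> qsym" is "\<lambda>f m. - f m"
  using bounded_degree_mult [where c = "-1"] quasisymmetric_mult [where c = "-1"] by simp

definition minus_qsym :: "qsym \<Rightarrow> qsym \<Rightarrow> qsym" where
  "minus_qsym f g = f + (- g)"

instance
proof
  fix a b c :: qsym
  show "a + b + c = a + (b + c)"
    by transfer (simp add: add.assoc)
  show "a + b = b + a"
    by transfer (simp add: add.commute)
  show "0 + a = a"
    by transfer simp
  show "- a + a = 0"
    by transfer simp
  show "a - b = a + - b"
    by (rule minus_qsym_def)
qed

end

lift_definition qscale :: "ratfun \<Rightarrow> qsym \<Rightarrow> qsym" is "\<lambda>c f m. c * f m"
  by (simp add: bounded_degree_mult quasisymmetric_mult)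

lemma vector_space_qscale: "vector_space qscale"
proof
  fix a b :: ratfun and f h :: qsym
  show "qscale a (f + h) = qscale a f + qscale a h"
    by transfer (simp add: distrib_left)
  show "qscale (a + b) f = qscale a f + qscale b f"
    by transfer (simp add: distrib_right)
  show "qscale a (qscale b f) = qscale (a * b) f"
    by transfer (simp add: mult.assoc)
  show "qscale 1 f = f"
    by transfer simp
qed

text \<open>
  For a composition \<open>\<alpha>\<close> a monomial occurs at most once in the sum defining \<open>M\<^sub>\<alpha>\<close>.
\<close>

definition M_qsym :: "nat list \<Rightarrow> qsym" where
  "M_qsym \<alpha> = Abs_qsym (\<lambda>m. of_bool
     (\<exists>is. length is = length \<alpha> \<and> sorted_wrt (<) is \<and> m = exps is \<alpha>))"

lemma length_le_sum_list: "is_composition \<alpha> \<Longrightarrow> length \<alpha> \<le> sum_list \<alpha>"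
  by (induction \<alpha>) (auto simp: is_composition_def)

lemma finite_compositions: "finite {\<alpha>. is_composition \<alpha> \<and> sum_list \<alpha> \<le> n}"
proof (rule finite_subset)
  show "{\<alpha>. is_composition \<alpha> \<and> sum_list \<alpha> \<le> n} \<subseteq> {\<alpha>. set \<alpha> \<subseteq> {..n} \<and> length \<alpha> \<le> n}"
    using length_le_sum_list member_le_sum_list by (fastforce intro: order_trans)
qed (simp add: finite_lists_length_le)

lemma lookup_exps:
  assumes "length is = length \<alpha>" "sorted_wrt (<) is" "k < length \<alpha>"
  shows "Poly_Mapping.lookup (exps is \<alpha>) (is ! k) = \<alpha> ! k"
proof -
  have "distinct is"
    using assms(2) strict_sorted_iff by blast
  have "Poly_Mapping.lookup (exps is \<alpha>) (is ! k) = (\<Sum>j<length \<alpha>. if j = k then \<alpha> ! k else 0)"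
    unfolding exps_def lookup_sum lookup_single
    by (rule sum.cong) (use assms \<open>distinct is\<close> in \<open>auto simp: when_def nth_eq_iff_index_eq\<close>)
  then show ?thesis
    using assms(3) by simp
qed

lemma lookup_exps_notin:
  assumes "length is = length \<alpha>" "i \<notin> set is"
  shows "Poly_Mapping.lookup (exps is \<alpha>) i = 0"
  unfolding exps_def lookup_sum lookup_single
  by (rule sum.neutral) (use assms in \<open>auto simp: when_def\<close>)

lemma keys_exps:
  assumes "is_composition \<alpha>" "length is = length \<alpha>" "sorted_wrt (<) is"
  shows "Poly_Mapping.keys (exps is \<alpha>) = set is"
proof (intro set_eqI iffI)
  fix i assume "i \<in> Poly_Mapping.keys (exps is \<alpha>)"
  then show "i \<in> set is"
    using lookup_exps_notin [OF assms(2)] by (metis in_keys_iff)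
next
  fix i assume "i \<in> set is"
  then obtain k where "k < length \<alpha>" "i = is ! k"
    using assms(2) by (metis in_set_conv_nth)
  then have "Poly_Mapping.lookup (exps is \<alpha>) i \<noteq> 0"
    using lookup_exps [OF assms(2,3)] assms(1) by (metis is_composition_def nth_mem not_less0)
  then show "i \<in> Poly_Mapping.keys (exps is \<alpha>)"
    by (simp add: in_keys_iff)
qed

lemma exps_eq_iff:
  assumes "is_composition \<alpha>" "length is = length \<alpha>" "sorted_wrt (<) is"
    and "is_composition \<beta>" "length js = length \<beta>" "sorted_wrt (<) js"
  shows "exps is \<alpha> = exps js \<beta> \<longleftrightarrow> is = js \<and> \<alpha> = \<beta>"
proof
  assume eq: "exps is \<alpha> = exps js \<beta>"
  have "set is = set js"
    using keys_exps assms eq by metis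
  then have "is = js"
    using assms(3,6) by (meson sorted_distinct_set_unique strict_sorted_iff)
  moreover have "\<alpha> = \<beta>"
  proof (rule nth_equalityI)
    show "length \<alpha> = length \<beta>"
      using assms(2,5) \<open>is = js\<close> by simp
    fix k assume "k < length \<alpha>"
    then show "\<alpha> ! k = \<beta> ! k"
      using lookup_exps [OF assms(2,3)] lookup_exps [OF assms(5,6)] eq \<open>is = js\<close> assms(2,5)
      by metis
  qed
  ultimately show "is = js \<and> \<alpha> = \<beta>" by simp
qed simp

lemma obtain_exps:
  obtains "is" \<alpha> where "is_composition \<alpha>" "length is = length \<alpha>" "sorted_wrt (<) is"
    "m = exps is \<alpha>"
proof -
  define js where "js = sorted_list_of_set (Poly_Mapping.keys m)"
  define \<alpha> where "\<alpha> = map (Poly_Mapping.lookup m) js"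
  have js: "set js = Poly_Mapping.keys m" "sorted_wrt (<) js"
    by (simp_all add: js_def)
  have len: "length js = length \<alpha>"
    by (simp add: \<alpha>_def)
  have "is_composition \<alpha>"
    using js(1) by (auto simp: is_composition_def \<alpha>_def in_keys_iff)
  moreover have "m = exps js \<alpha>"
  proof (rule poly_mapping_eqI)
    fix i
    show "Poly_Mapping.lookup m i = Poly_Mapping.lookup (exps js \<alpha>) i"
    proof (cases "i \<in> set js")
      case True
      then obtain k where "k < length js" "i = js ! k"
        by (metis in_set_conv_nth)
      then show ?thesis
        using lookup_exps [OF len js(2), of k] by (simp add: \<alpha>_def)
    next
      case False
      then show ?thesis
        using lookup_exps_notin [OF len False] js(1) by (simp add: in_keys_iff)
    qed
  qed
  ultimately show thesis
    using that len js(2) by blast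
qed

lemma total_degree_exps:
  assumes "is_composition \<alpha>" "length is = length \<alpha>" "sorted_wrt (<) is"
  shows "total_degree (exps is \<alpha>) = sum_list \<alpha>"
proof -
  have "distinct is"
    using assms(3) strict_sorted_iff by blast
  then have "bij_betw ((!) is) {..<length \<alpha>} (set is)"
    using assms(2) by (metis bij_betw_nth)
  then have "total_degree (exps is \<alpha>) = (\<Sum>k<length \<alpha>. Poly_Mapping.lookup (exps is \<alpha>) (is ! k))"
    unfolding total_degree_def keys_exps [OF assms] by (metis sum.reindex_bij_betw)
  also have "\<dots> = (\<Sum>k<length \<alpha>. \<alpha> ! k)"
    using lookup_exps [OF assms(2,3)] by simp
  finally show ?thesis
    by (simp add: sum_list_sum_nth atLeast0LessThan)
qed

lemma coeff_M_qsym: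
  assumes "is_composition \<alpha>"
  shows "coeff_qsym (M_qsym \<alpha>) m = of_bool
     (\<exists>is. length is = length \<alpha> \<and> sorted_wrt (<) is \<and> m = exps is \<alpha>)"
proof -
  let ?f = "\<lambda>m. of_bool (\<exists>is. length is = length \<alpha> \<and> sorted_wrt (<) is \<and> m = exps is \<alpha>) :: ratfun"
  have "bounded_degree ?f"
    unfolding bounded_degree_def using total_degree_exps [OF assms] by auto
  moreover have "quasisymmetric ?f"
    unfolding quasisymmetric_def using exps_eq_iff [OF _ _ _ assms]
    by (intro allI impI arg_cong [where f = of_bool]) (metis (no_types))
  ultimately show ?thesis
    unfolding M_qsym_def by (simp add: Abs_qsym_inverse)
qed

definition M_coord :: "nat list \<Rightarrow> qsym \<Rightarrow> ratfun" where
  "M_coord \<alpha> f = coeff_qsym f (exps [0..<length \<alpha>] \<alpha>)"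

lemma coeff_qsym_exps:
  assumes "is_composition \<alpha>" "length is = length \<alpha>" "sorted_wrt (<) is"
  shows "coeff_qsym f (exps is \<alpha>) = M_coord \<alpha> f"
proof -
  have "quasisymmetric (coeff_qsym f)"
    using coeff_qsym [of f] by simp
  then show ?thesis
    unfolding quasisymmetric_def M_coord_def
    by (elim allE [of _ \<alpha>] allE [of _ "is"] allE [of _ "[0..<length \<alpha>]"] impE)
      (use assms in simp_all)
qed

lemma M_coord_M_qsym:
  assumes "is_composition \<alpha>" "is_composition \<beta>"
  shows "M_coord \<beta> (M_qsym \<alpha>) = of_bool (\<alpha> = \<beta>)"
  unfolding M_coord_def coeff_M_qsym [OF assms(1)]
  by (rule arg_cong [where f = of_bool])
    (metis assms exps_eq_iff length_upt diff_zero sorted_wrt_upt)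

lemma M_coord_add: "M_coord \<alpha> (f + g) = M_coord \<alpha> f + M_coord \<alpha> g"
  by (simp add: M_coord_def plus_qsym.rep_eq)

lemma M_coord_qscale: "M_coord \<alpha> (qscale c f) = c * M_coord \<alpha> f"
  by (simp add: M_coord_def qscale.rep_eq)

definition M_supp :: "qsym \<Rightarrow> nat list set" where
  "M_supp f = {\<alpha>. is_composition \<alpha> \<and> M_coord \<alpha> f \<noteq> 0}"

lemma finite_M_supp: "finite (M_supp f)"
proof -
  obtain n where n: "\<And>m. coeff_qsym f m \<noteq> 0 \<Longrightarrow> total_degree m \<le> n"
    using coeff_qsym [of f] unfolding bounded_degree_def by blast
  have "M_supp f \<subseteq> {\<alpha>. is_composition \<alpha> \<and> sum_list \<alpha> \<le> n}"
    using n total_degree_exps by (fastforce simp: M_supp_def M_coord_def)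
  then show ?thesis
    using finite_compositions finite_subset by blast
qed

lemma coeff_qsym_sum: "coeff_qsym (sum h S) m = (\<Sum>x\<in>S. coeff_qsym (h x) m)"
  by (induction S rule: infinite_finite_induct) (simp_all add: zero_qsym.rep_eq plus_qsym.rep_eq)

lemma M_expansion: "f = (\<Sum>\<alpha>\<in>M_supp f. qscale (M_coord \<alpha> f) (M_qsym \<alpha>))"
proof (rule coeff_qsym_inject [THEN iffD1], rule ext)
  fix m
  obtain "is" \<beta> where \<beta>: "is_composition \<beta>" "length is = length \<beta>" "sorted_wrt (<) is"
    "m = exps is \<beta>"
    by (rule obtain_exps)
  have "coeff_qsym (\<Sum>\<alpha>\<in>M_supp f. qscale (M_coord \<alpha> f) (M_qsym \<alpha>)) m =
      (\<Sum>\<alpha>\<in>M_supp f. M_coord \<alpha> f * M_coord \<beta> (M_qsym \<alpha>))"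
    unfolding \<beta>(4) coeff_qsym_exps [OF \<beta>(1-3)]
    by (simp add: M_coord_def coeff_qsym_sum qscale.rep_eq)
  also have "\<dots> = (\<Sum>\<alpha>\<in>M_supp f. if \<alpha> = \<beta> then M_coord \<beta> f else 0)"
    by (rule sum.cong) (auto simp: M_supp_def M_coord_M_qsym \<beta>(1))
  also have "\<dots> = M_coord \<beta> f"
    using finite_M_supp [of f] \<beta>(1) by (simp add: M_supp_def)
  finally show "coeff_qsym f m =
      coeff_qsym (\<Sum>\<alpha>\<in>M_supp f. qscale (M_coord \<alpha> f) (M_qsym \<alpha>)) m"
    by (simp add: \<beta>(4) coeff_qsym_exps [OF \<beta>(1-3)])
qed

definition L_qsym :: "nat list \<Rightarrow> qsym" where
  "L_qsym \<alpha> = (\<Sum>\<beta> | \<beta> \<preceq> \<alpha>. M_qsym \<beta>)"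

definition wt :: "nat set \<Rightarrow> nat \<Rightarrow> nat" where
  "wt I i = card ({1..i - 1} \<inter> I) + 1"

definition G_qsym :: "nat list \<Rightarrow> qsym" where
  "G_qsym \<alpha> = (\<Sum>\<beta> | \<beta> \<preceq> \<alpha>.
     qscale ((-1) ^ (length \<beta> - length \<alpha>) *
             q ^ (\<Sum>i\<in>comp_set \<beta> - comp_set \<alpha>. wt (comp_set \<alpha>) i)) (L_qsym \<beta>))"

section \<open>The tensor square of the space of quasisymmetric functions\<close>

text \<open>
  The tensor product over the base field, as the free vector space on pairs modulo the subspace
  generated by the bilinearity relations.
\<close>

type_synonym free_qsym2 = "qsym \<times> qsym \<Rightarrow>\<^sub>0 ratfun"

definition free_scale :: "ratfun \<Rightarrow> free_qsym2 \<Rightarrow> free_qsym2" where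
  "free_scale c p = Poly_Mapping.map ((*) c) p"

abbreviation free_pair :: "qsym \<Rightarrow> qsym \<Rightarrow> free_qsym2" where
  "free_pair f g \<equiv> Poly_Mapping.single (f, g) 1"

lemma lookup_free_scale [simp]:
  "Poly_Mapping.lookup (free_scale c p) x = c * Poly_Mapping.lookup p x"
  by (simp add: free_scale_def map.rep_eq when_def)

lemma vector_space_free_scale: "vector_space free_scale"
  by standard (simp_all add: poly_mapping_eq_iff fun_eq_iff lookup_add
      distrib_left distrib_right mult.assoc)

definition bilinear_relators :: "free_qsym2 set" where
  "bilinear_relators =
     {free_pair (f + g) h - free_pair f h - free_pair g h | f g h. True} \<union>
     {free_pair f (g + h) - free_pair f g - free_pair f h | f g h. True} \<union>
     {free_pair (qscale c f) g - free_scale c (free_pair f g) | c f g. True} \<union>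
     {free_pair f (qscale c g) - free_scale c (free_pair f g) | c f g. True}"

definition tensor_rel :: "free_qsym2 \<Rightarrow> free_qsym2 \<Rightarrow> bool" where
  "tensor_rel p r \<longleftrightarrow> p - r \<in> module.span free_scale bilinear_relators"

interpretation free: vector_space free_scale
  by (rule vector_space_free_scale)

lemma equivp_tensor_rel: "equivp tensor_rel"
proof (rule equivpI)
  show "reflp tensor_rel"
    by (simp add: reflp_def tensor_rel_def free.span_zero)
  show "symp tensor_rel"
    unfolding symp_def tensor_rel_def using free.span_neg by fastforce
  show "transp tensor_rel"
    unfolding transp_def tensor_rel_def
  proof (intro allI impI)
    fix x y z
    assume "x - y \<in> free.span bilinear_relators" "y - z \<in> free.span bilinear_relators"
    from free.span_add [OF this] show "x - z \<in> free.span bilinear_relators"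
      by simp
  qed
qed

quotient_type qsym_tensor = free_qsym2 / tensor_rel
  by (rule equivp_tensor_rel)

instantiation qsym_tensor :: ab_group_add
begin

lift_definition zero_qsym_tensor :: qsym_tensor is 0 .

lift_definition plus_qsym_tensor :: "qsym_tensor \<Rightarrow> qsym_tensor \<Rightarrow> qsym_tensor" is "(+)"
  unfolding tensor_rel_def by (simp only: add_diff_add free.span_add)

lift_definition uminus_qsym_tensor :: "qsym_tensor \<Rightarrow> qsym_tensor" is uminus
  unfolding tensor_rel_def minus_diff_minus by (rule free.span_neg)

definition minus_qsym_tensor :: "qsym_tensor \<Rightarrow> qsym_tensor \<Rightarrow> qsym_tensor" where
  "minus_qsym_tensor s t = s + (- t)"

instance
proof
  fix a b c :: qsym_tensor
  show "a + b + c = a + (b + c)"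
    by transfer (simp add: tensor_rel_def add.assoc free.span_zero)
  show "a + b = b + a"
    by transfer (simp add: tensor_rel_def add.commute free.span_zero)
  show "0 + a = a"
    by transfer (simp add: tensor_rel_def free.span_zero)
  show "- a + a = 0"
    by transfer (simp add: tensor_rel_def free.span_zero)
  show "a - b = a + - b"
    by (rule minus_qsym_tensor_def)
qed

end

lift_definition tscale :: "ratfun \<Rightarrow> qsym_tensor \<Rightarrow> qsym_tensor" is free_scale
  unfolding tensor_rel_def free.scale_right_diff_distrib [symmetric] by (rule free.span_scale)

lift_definition tensor :: "qsym \<Rightarrow> qsym \<Rightarrow> qsym_tensor" (infixr \<open>\<otimes>\<close> 70) is free_pair .

lemma vector_space_tscale: "vector_space tscale"
proof
  fix a b :: ratfun and x y :: qsym_tensor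
  show "tscale a (x + y) = tscale a x + tscale a y"
    by transfer (simp add: tensor_rel_def free.scale_right_distrib free.span_zero)
  show "tscale (a + b) x = tscale a x + tscale b x"
    by transfer (simp add: tensor_rel_def free.scale_left_distrib free.span_zero)
  show "tscale a (tscale b x) = tscale (a * b) x"
    by transfer (simp add: tensor_rel_def free.span_zero)
  show "tscale 1 x = x"
    by transfer (simp add: tensor_rel_def free.span_zero)
qed

lemma tensor_add_left: "(f + g) \<otimes> h = f \<otimes> h + g \<otimes> h"
proof transfer
  fix f g h
  have "free_pair (f + g) h - free_pair f h - free_pair g h \<in> bilinear_relators"
    unfolding bilinear_relators_def by blast
  from free.span_base [OF this]
  show "tensor_rel (free_pair (f + g) h) (free_pair f h + free_pair g h)"
    by (simp only: tensor_rel_def diff_diff_eq)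
qed

lemma tensor_add_right: "f \<otimes> (g + h) = f \<otimes> g + f \<otimes> h"
proof transfer
  fix f g h
  have "free_pair f (g + h) - free_pair f g - free_pair f h \<in> bilinear_relators"
    unfolding bilinear_relators_def by blast
  from free.span_base [OF this]
  show "tensor_rel (free_pair f (g + h)) (free_pair f g + free_pair f h)"
    by (simp only: tensor_rel_def diff_diff_eq)
qed

lemma tensor_scale_left: "qscale c f \<otimes> g = tscale c (f \<otimes> g)"
proof transfer
  fix c f g
  have "free_pair (qscale c f) g - free_scale c (free_pair f g) \<in> bilinear_relators"
    unfolding bilinear_relators_def by blast
  from free.span_base [OF this]
  show "tensor_rel (free_pair (qscale c f) g) (free_scale c (free_pair f g))"
    by (simp only: tensor_rel_def)
qed

lemma tensor_scale_right: "f \<otimes> qscale c g = tscale c (f \<otimes> g)"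
proof transfer
  fix c f g
  have "free_pair f (qscale c g) - free_scale c (free_pair f g) \<in> bilinear_relators"
    unfolding bilinear_relators_def by blast
  from free.span_base [OF this]
  show "tensor_rel (free_pair f (qscale c g)) (free_scale c (free_pair f g))"
    by (simp only: tensor_rel_def)
qed

section \<open>The coproduct\<close>

definition is_coproduct :: "(qsym \<Rightarrow> qsym_tensor) \<Rightarrow> bool" where
  "is_coproduct D \<longleftrightarrow> Vector_Spaces.linear qscale tscale D \<and>
     (\<forall>\<alpha>. is_composition \<alpha> \<longrightarrow>
        D (M_qsym \<alpha>) =
          (\<Sum>(\<beta>, \<gamma>) | is_composition \<beta> \<and> is_composition \<gamma> \<and> \<beta> @ \<gamma> = \<alpha>.
             M_qsym \<beta> \<otimes> M_qsym \<gamma>))"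

definition coproduct :: "qsym \<Rightarrow> qsym_tensor" (\<open>\<triangle>\<close>) where
  "\<triangle> = (THE D. is_coproduct D)"

text \<open>
  The description is proper, as the \<open>M_qsym \<alpha>\<close> form a basis.
\<close>

lemma ex1_coproduct: "\<exists>!D. is_coproduct D"
proof (rule ex_ex1I)
  interpret T: vector_space tscale
    by (rule vector_space_tscale)
  interpret Q: vector_space qscale
    by (rule vector_space_qscale)
  define \<Phi> where "\<Phi> \<alpha> =
    (\<Sum>(\<beta>, \<gamma>) | is_composition \<beta> \<and> is_composition \<gamma> \<and> \<beta> @ \<gamma> = \<alpha>. M_qsym \<beta> \<otimes> M_qsym \<gamma>)" for \<alpha>
  define D where "D f = (\<Sum>\<alpha>\<in>M_supp f. tscale (M_coord \<alpha> f) (\<Phi> \<alpha>))" for f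
  have D: "D f = (\<Sum>\<alpha>\<in>S. tscale (M_coord \<alpha> f) (\<Phi> \<alpha>))"
    if "finite S" "M_supp f \<subseteq> S" "\<forall>\<alpha>\<in>S. is_composition \<alpha>" for S f
    unfolding D_def by (rule sum.mono_neutral_left) (use that in \<open>auto simp: M_supp_def\<close>)
  have comp: "\<forall>\<alpha>\<in>M_supp f. is_composition \<alpha>" for f
    by (simp add: M_supp_def)
  have "D (f + h) = D f + D h" for f h
  proof -
    let ?S = "M_supp f \<union> M_supp h \<union> M_supp (f + h)"
    have S: "finite ?S" "\<forall>\<alpha>\<in>?S. is_composition \<alpha>"
      using finite_M_supp comp by auto
    have "D f = (\<Sum>\<alpha>\<in>?S. tscale (M_coord \<alpha> f) (\<Phi> \<alpha>))"
      "D h = (\<Sum>\<alpha>\<in>?S. tscale (M_coord \<alpha> h) (\<Phi> \<alpha>))"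
      "D (f + h) = (\<Sum>\<alpha>\<in>?S. tscale (M_coord \<alpha> (f + h)) (\<Phi> \<alpha>))"
      by (rule D [OF S(1) _ S(2)]; blast)+
    then show ?thesis
      by (simp add: M_coord_add T.scale_left_distrib sum.distrib)
  qed
  moreover have "D (qscale c f) = tscale c (D f)" for c f
  proof -
    let ?S = "M_supp f \<union> M_supp (qscale c f)"
    have S: "finite ?S" "\<forall>\<alpha>\<in>?S. is_composition \<alpha>"
      using finite_M_supp comp by auto
    have "D f = (\<Sum>\<alpha>\<in>?S. tscale (M_coord \<alpha> f) (\<Phi> \<alpha>))"
      "D (qscale c f) = (\<Sum>\<alpha>\<in>?S. tscale (M_coord \<alpha> (qscale c f)) (\<Phi> \<alpha>))"
      by (rule D [OF S(1) _ S(2)]; blast)+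
    then show ?thesis
      by (simp add: M_coord_qscale T.scale_sum_right)
  qed
  ultimately have "Vector_Spaces.linear qscale tscale D"
    by unfold_locales
  moreover have "D (M_qsym \<alpha>) = \<Phi> \<alpha>" if "is_composition \<alpha>" for \<alpha>
  proof -
    have "M_supp (M_qsym \<alpha>) = {\<alpha>}"
      using that by (auto simp: M_supp_def M_coord_M_qsym)
    then show ?thesis
      using that by (simp add: D_def M_coord_M_qsym)
  qed
  ultimately show "\<exists>D. is_coproduct D"
    unfolding is_coproduct_def \<Phi>_def by blast
next
  fix D E assume DE: "is_coproduct D" "is_coproduct E"
  interpret D: Vector_Spaces.linear qscale tscale D
    using DE(1) by (simp add: is_coproduct_def)
  interpret E: Vector_Spaces.linear qscale tscale E
    using DE(2) by (simp add: is_coproduct_def)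
  show "D = E"
  proof
    fix f
    let ?e = "\<Sum>\<alpha>\<in>M_supp f. qscale (M_coord \<alpha> f) (M_qsym \<alpha>)"
    have "D ?e = E ?e"
      unfolding D.sum E.sum D.scale E.scale
      by (rule sum.cong) (use DE in \<open>simp_all add: is_coproduct_def M_supp_def\<close>)
    then show "D f = E f"
      by (simp flip: M_expansion)
  qed
qed

lemma is_coproduct_coproduct: "is_coproduct \<triangle>"
  unfolding coproduct_def by (rule theI' [OF ex1_coproduct])

section \<open>The structure coefficients\<close>

definition g_exp :: "nat list \<Rightarrow> nat list \<Rightarrow> nat" where
  "g_exp \<beta> \<beta>' = (let js = sorted_list_of_set (comp_set \<beta>') in
     \<Sum>k | k \<in> {1..length js} \<and> js ! (k - 1) \<notin> comp_set \<beta>. k)"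

definition c_coeff :: "nat \<Rightarrow> nat \<Rightarrow> ratfun" where
  "c_coeff u v = (if v > u then 0 else \<Prod>i<v. 1 - q ^ (u - i))"

text \<open>
  For \<open>\<beta>' \<preceq> \<beta>\<close> the length of \<open>\<beta>'\<close> is at least that of \<open>\<beta>\<close>, so subtraction does not truncate.
\<close>

definition d_coeff :: "nat list \<Rightarrow> nat list \<Rightarrow> nat list \<Rightarrow> nat list \<Rightarrow> ratfun" where
  "d_coeff \<alpha> \<beta> \<beta>' \<gamma> = (if \<alpha> @ \<beta> = \<gamma> then c_coeff (length \<alpha>) (length \<beta>' - length \<beta>)
     else c_coeff (length \<alpha>) (length \<beta>' - length \<beta> + 1))"

end

theory Submission
  imports Defs
begin

text \<open>
  Write \<open>I\<close> and \<open>K\<close> for the sets of \<open>\<alpha>\<close> and of a refinement \<open>\<kappa>\<close> of \<open>\<alpha>\<close>. Substituting the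
  expansion of \<open>L_qsym\<close> into the definition of \<open>G_qsym \<alpha>\<close>, the coefficient of \<open>M_qsym \<kappa>\<close> becomes an
  alternating sum over all sets between \<open>I\<close> and \<open>K\<close>. This sum factors: it is the product of
  \<open>1 - q ^ wt I i\<close> over \<open>i \<in> K - I\<close> (\<open>G_qsym_eq_sum_M_qsym\<close>). The theorem is then an
  identity between coefficients of \<open>M_qsym \<mu> \<otimes> M_qsym \<nu>\<close>.

  On the left this coefficient is the product for the refinement \<open>\<mu> @ \<nu>\<close> of \<open>\<gamma>\<close>. Cutting \<open>\<gamma>\<close> at
  the size of \<open>\<mu>\<close> yields exactly one pair \<open>(\<alpha>, \<beta>)\<close> whose concatenation or near-concatenation is
  \<open>\<gamma>\<close> and whose members are refined by \<open>\<mu>\<close> and \<open>\<nu>\<close>, so only this pair contributes on the right. The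
  product splits at the cut (\<open>hl_weight_cut\<close>). The positions before the cut give the coefficient of
  \<open>M_qsym \<mu>\<close> in \<open>G_qsym \<alpha>\<close>. The positions after it give the analogous product for \<open>\<beta>\<close>
  and \<open>\<nu>\<close>, but with all weights raised by the number \<open>l\<close> of elements of the set of \<open>\<gamma>\<close> up to the
  cut (for nonempty \<open>\<alpha>\<close> and \<open>\<beta>\<close>): \<open>l = length \<alpha>\<close> for a concatenation, \<open>l = length \<alpha> - 1\<close> for a
  near-concatenation. In the latter case the cut itself contributes \<open>1 - q ^ length \<alpha>\<close>, which is
  what turns \<open>c_coeff (length \<alpha> - 1) v\<close> into \<open>c_coeff (length \<alpha>) (v + 1)\<close>.

  It remains to expand a product with raised weights in products with the original weights, but
  taken with respect to the sets between \<open>I\<close> and \<open>K\<close>. This is \<open>hl_weight_shift\<close>, proved by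
  induction on the largest element of \<open>K\<close>; the powers of \<open>q\<close> in it are \<open>g_exp\<close>, because the rank of
  an element in a set is its weight with respect to that set.
\<close>

section \<open>Compositions and their partial sums\<close>

lemma is_composition_simps [simp]:
  "is_composition []"
  "is_composition (a # \<alpha>) \<longleftrightarrow> 0 < a \<and> is_composition \<alpha>"
  "is_composition (\<alpha> @ \<beta>) \<longleftrightarrow> is_composition \<alpha> \<and> is_composition \<beta>"
  by (auto simp: is_composition_def)

lemma sum_list_eq_0_composition: "is_composition \<alpha> \<Longrightarrow> sum_list \<alpha> = 0 \<longleftrightarrow> \<alpha> = []"
  by (cases \<alpha>) auto

lemma sum_list_take_less:
  assumes "is_composition \<alpha>" "j < k" "k \<le> length \<alpha>"
  shows "sum_list (take j \<alpha>) < sum_list (take k \<alpha>)"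
proof -
  let ?\<delta> = "take (k - j) (drop j \<alpha>)"
  have "take k \<alpha> = take j \<alpha> @ ?\<delta>"
    using assms(2) take_add [of j "k - j" \<alpha>] by simp
  moreover have "is_composition ?\<delta>"
    using assms(1) in_set_takeD in_set_dropD unfolding is_composition_def by metis
  moreover have "?\<delta> \<noteq> []"
    using assms(2,3) by simp
  ultimately show ?thesis
    using sum_list_eq_0_composition [of ?\<delta>] by (metis gr0I less_add_same_cancel1 sum_list_append)
qed

lemma comp_set_subset:
  assumes "is_composition \<alpha>"
  shows "comp_set \<alpha> \<subseteq> {0<..<sum_list \<alpha>}"
  using sum_list_take_less [OF assms, of 0] sum_list_take_less [OF assms, of _ "length \<alpha>"]
  unfolding comp_set_def by force

lemma finite_comp_set [simp]: "finite (comp_set \<alpha>)"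
  by (simp add: comp_set_def)

lemma card_comp_set:
  assumes "is_composition \<alpha>"
  shows "card (comp_set \<alpha>) = length \<alpha> - 1"
proof -
  have "inj_on (\<lambda>k. sum_list (take k \<alpha>)) {1..<length \<alpha>}"
    by (rule linorder_inj_onI) (use sum_list_take_less [OF assms] in force)+
  then show ?thesis
    unfolding comp_set_def by (simp add: card_image)
qed

lemma comp_set_Nil [simp]: "comp_set [] = {}"
  and comp_set_singleton [simp]: "comp_set [a] = {}"
  by (simp_all add: comp_set_def)

lemma comp_set_append:
  assumes "\<alpha> \<noteq> []" "\<beta> \<noteq> []"
  shows "comp_set (\<alpha> @ \<beta>) = insert (sum_list \<alpha>) (comp_set \<alpha> \<union> (+) (sum_list \<alpha>) ` comp_set \<beta>)"
proof -
  let ?f = "\<lambda>k. sum_list (take k (\<alpha> @ \<beta>))"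
  have "{1..<length (\<alpha> @ \<beta>)} =
      insert (length \<alpha>) ({1..<length \<alpha>} \<union> (+) (length \<alpha>) ` {1..<length \<beta>})"
    using assms by (auto simp: Suc_le_eq)
  moreover have "?f ` {1..<length \<alpha>} = comp_set \<alpha>"
    unfolding comp_set_def by (rule image_cong) auto
  moreover have "?f ` (+) (length \<alpha>) ` {1..<length \<beta>} = (+) (sum_list \<alpha>) ` comp_set \<beta>"
    unfolding comp_set_def image_image by (rule image_cong) auto
  ultimately show ?thesis
    unfolding comp_set_def [of "\<alpha> @ \<beta>"] by (simp add: image_Un)
qed

lemma comp_set_Cons: "\<alpha> \<noteq> [] \<Longrightarrow> comp_set (a # \<alpha>) = insert a ((+) a ` comp_set \<alpha>)"
  using comp_set_append [of "[a]" \<alpha>] by simp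

lemma near_concat_Cons: "\<alpha> \<noteq> [] \<Longrightarrow> (a # \<alpha>) \<odot> \<beta> = a # (\<alpha> \<odot> \<beta>)"
  by (cases \<alpha>; cases \<beta>) auto

lemma near_concat_Nil_right [simp]: "\<alpha> \<odot> [] = \<alpha>"
  by (cases \<alpha>) auto

lemma near_concat_eq_Nil_iff [simp]: "\<alpha> \<odot> \<beta> = [] \<longleftrightarrow> \<alpha> = [] \<and> \<beta> = []"
  by (cases \<alpha>; cases \<beta>) auto

lemma sum_list_near_concat: "sum_list (\<alpha> \<odot> \<beta>) = sum_list \<alpha> + sum_list \<beta>"
proof (induction \<alpha>)
  case (Cons a \<alpha>)
  show ?case
  proof (cases "\<alpha> = []")
    case True
    then show ?thesis
      by (cases \<beta>) simp_all
  next
    case False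
    then show ?thesis
      using Cons.IH by (simp add: near_concat_Cons)
  qed
qed simp

lemma comp_set_near_concat:
  assumes "\<alpha> \<noteq> []" "\<beta> \<noteq> []"
  shows "comp_set (\<alpha> \<odot> \<beta>) = comp_set \<alpha> \<union> (+) (sum_list \<alpha>) ` comp_set \<beta>"
  using assms
proof (induction \<alpha>)
  case (Cons a \<alpha>)
  show ?case
  proof (cases "\<alpha> = []")
    case True
    obtain b \<beta>' where \<beta>: "\<beta> = b # \<beta>'"
      using Cons.prems by (cases \<beta>) auto
    then show ?thesis
      using True by (cases "\<beta>' = []") (simp_all add: comp_set_Cons image_image add.assoc)
  next
    case False
    then have "comp_set ((a # \<alpha>) \<odot> \<beta>) =
        insert a ((+) a ` (comp_set \<alpha> \<union> (+) (sum_list \<alpha>) ` comp_set \<beta>))"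
      using Cons by (simp add: near_concat_Cons comp_set_Cons)
    then show ?thesis
      using False by (simp add: comp_set_Cons image_Un image_image add.assoc)
  qed
qed simp

text \<open>
  Removing the largest partial sum from the set removes the last part of the composition, which
  is what makes the induction work.
\<close>

lemma obtain_composition_of_comp_set:
  assumes "finite J" "J \<subseteq> {0<..<n}"
  obtains \<beta> where "is_composition \<beta>" "sum_list \<beta> = n" "comp_set \<beta> = J"
proof -
  have "\<exists>\<beta>. is_composition \<beta> \<and> sum_list \<beta> = n \<and> comp_set \<beta> = J"
    using assms
  proof (induction J arbitrary: n rule: finite_linorder_max_induct)
    case empty
    show ?case
      by (cases "n = 0") (auto intro: exI [of _ "[]"] exI [of _ "[n]"])
  next
    case (insert m J)
    then have "J \<subseteq> {0<..<m}" "0 < m" "m < n"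
      by auto
    with insert.IH obtain \<beta> where \<beta>: "is_composition \<beta>" "sum_list \<beta> = m" "comp_set \<beta> = J"
      by blast
    then have "\<beta> \<noteq> []"
      using \<open>0 < m\<close> by auto
    then have "is_composition (\<beta> @ [n - m]) \<and> sum_list (\<beta> @ [n - m]) = n \<and>
        comp_set (\<beta> @ [n - m]) = insert m J"
      using \<beta> \<open>m < n\<close> by (simp add: comp_set_append)
    then show ?case
      by blast
  qed
  then show thesis
    using that by blast
qed

text \<open>
  The largest element of the set is the size of the composition without its last part; so the set and the
  total size determine the last part, and induction applies to the rest.
\<close>

lemma comp_set_inject:
  assumes "is_composition \<alpha>" "is_composition \<beta>" "sum_list \<alpha> = sum_list \<beta>"
    and "comp_set \<alpha> = comp_set \<beta>"
  shows "\<alpha> = \<beta>"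
  using assms
proof (induction \<alpha> arbitrary: \<beta> rule: rev_induct)
  case Nil
  then show ?case
    using sum_list_eq_0_composition [of \<beta>] by simp
next
  case (snoc a \<alpha>)
  have Max_snoc: "Max (comp_set (\<delta> @ [d])) = sum_list \<delta> \<and> comp_set (\<delta> @ [d]) \<noteq> {} \<and>
      comp_set \<delta> = comp_set (\<delta> @ [d]) - {sum_list \<delta>}"
    if "is_composition (\<delta> @ [d])" "\<delta> \<noteq> []" for \<delta> d
    using that comp_set_subset [of \<delta>]
    by (auto simp: comp_set_append Max_insert2 subset_iff less_imp_le)
  obtain b \<beta>' where \<beta>: "\<beta> = \<beta>' @ [b]"
    using snoc.prems sum_list_eq_0_composition [of "\<alpha> @ [a]"] by (cases \<beta> rule: rev_cases) auto
  show ?case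
  proof (cases "\<alpha> = [] \<or> \<beta>' = []")
    case True
    moreover have "comp_set (\<delta> @ [d]) = {} \<longleftrightarrow> \<delta> = []" for \<delta> and d :: nat
      by (cases "\<delta> = []") (simp_all add: comp_set_append)
    ultimately have "\<alpha> = [] \<and> \<beta>' = []"
      using snoc.prems(4) \<beta> by metis
    then show ?thesis
      using snoc.prems \<beta> by simp
  next
    case False
    then have "sum_list \<alpha> = sum_list \<beta>'" "comp_set \<alpha> = comp_set \<beta>'"
      using Max_snoc [of \<alpha> a] Max_snoc [of \<beta>' b] snoc.prems \<beta> by metis+
    then show ?thesis
      using snoc.IH [of \<beta>'] snoc.prems \<beta> by simp
  qed
qed

lemma refines_trans: "\<alpha> \<preceq> \<beta> \<Longrightarrow> \<beta> \<preceq> \<gamma> \<Longrightarrow> \<alpha> \<preceq> \<gamma>"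
  by (auto simp: refines_def)

lemma finite_refinements [simp]: "finite {\<beta>. \<beta> \<preceq> \<alpha>}"
  by (rule finite_subset [OF _ finite_compositions [of "sum_list \<alpha>"]]) (auto simp: refines_def)

lemma refines_Nil_right [simp]: "\<beta> \<preceq> [] \<longleftrightarrow> \<beta> = []"
  using sum_list_eq_0_composition [of \<beta>] by (auto simp: refines_def simp del: sum_list_eq_0_iff)

lemma card_comp_set_Diff:
  assumes "\<beta> \<preceq> \<alpha>"
  shows "card (comp_set \<beta> - comp_set \<alpha>) = length \<beta> - length \<alpha>"
proof (cases "\<alpha> = []")
  case True
  then show ?thesis
    using assms by simp
next
  case False
  then have "length \<alpha> \<noteq> 0"
    by simp
  then show ?thesis
    using assms by (simp add: refines_def card_Diff_subset card_comp_set)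
qed

text \<open>
  Refinement of compositions is inclusion of sets, so sums over an interval of compositions are sums
  over an interval of sets. All coefficient identities below are proved for sets and carried over.
\<close>

lemma bij_betw_comp_set_interval:
  assumes "\<kappa> \<preceq> \<alpha>"
  shows "bij_betw comp_set {\<beta>. \<beta> \<preceq> \<alpha> \<and> \<kappa> \<preceq> \<beta>} {J. comp_set \<alpha> \<subseteq> J \<and> J \<subseteq> comp_set \<kappa>}"
proof (rule bij_betw_imageI)
  show "inj_on comp_set {\<beta>. \<beta> \<preceq> \<alpha> \<and> \<kappa> \<preceq> \<beta>}"
  proof (rule inj_onI)
    fix \<beta> \<beta>'
    assume "\<beta> \<in> {\<beta>. \<beta> \<preceq> \<alpha> \<and> \<kappa> \<preceq> \<beta>}" "\<beta>' \<in> {\<beta>. \<beta> \<preceq> \<alpha> \<and> \<kappa> \<preceq> \<beta>}"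
      and eq: "comp_set \<beta> = comp_set \<beta>'"
    then have "\<beta> \<preceq> \<alpha>" "\<beta>' \<preceq> \<alpha>"
      by simp_all
    then show "\<beta> = \<beta>'"
      using comp_set_inject [OF _ _ _ eq] by (simp add: refines_def)
  qed
  show "comp_set ` {\<beta>. \<beta> \<preceq> \<alpha> \<and> \<kappa> \<preceq> \<beta>} = {J. comp_set \<alpha> \<subseteq> J \<and> J \<subseteq> comp_set \<kappa>}"
  proof (intro equalityI subsetI)
    fix J assume J: "J \<in> {J. comp_set \<alpha> \<subseteq> J \<and> J \<subseteq> comp_set \<kappa>}"
    have "finite J" "J \<subseteq> {0<..<sum_list \<kappa>}"
      using J assms comp_set_subset [of \<kappa>] finite_subset [of J "comp_set \<kappa>"]
      by (auto simp: refines_def)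
    then obtain \<beta> where "is_composition \<beta>" "sum_list \<beta> = sum_list \<kappa>" "comp_set \<beta> = J"
      by (rule obtain_composition_of_comp_set)
    then show "J \<in> comp_set ` {\<beta>. \<beta> \<preceq> \<alpha> \<and> \<kappa> \<preceq> \<beta>}"
      using J assms by (intro image_eqI [of _ _ \<beta>]) (auto simp: refines_def)
  next
    fix J assume "J \<in> comp_set ` {\<beta>. \<beta> \<preceq> \<alpha> \<and> \<kappa> \<preceq> \<beta>}"
    then obtain \<beta> where "J = comp_set \<beta>" "\<beta> \<preceq> \<alpha>" "\<kappa> \<preceq> \<beta>"
      by blast
    then show "J \<in> {J. comp_set \<alpha> \<subseteq> J \<and> J \<subseteq> comp_set \<kappa>}"
      by (simp add: refines_def)
  qed
qed

section \<open>Cutting a composition in two\<close>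

definition cuts :: "nat list \<Rightarrow> (nat list \<times> nat list) set" where
  "cuts \<gamma> = {(\<alpha>, \<beta>). is_composition \<alpha> \<and> is_composition \<beta> \<and> (\<alpha> @ \<beta> = \<gamma> \<or> \<alpha> \<odot> \<beta> = \<gamma>)}"

lemma cuts_cases:
  assumes "(\<alpha>, \<beta>) \<in> cuts \<gamma>"
  obtains (concat) "\<alpha> @ \<beta> = \<gamma>"
  | (near) "\<alpha> \<odot> \<beta> = \<gamma>" "\<alpha> @ \<beta> \<noteq> \<gamma>" "\<alpha> \<noteq> []" "\<beta> \<noteq> []"
  using assms by (cases "\<alpha> = []"; cases "\<beta> = []") (auto simp: cuts_def)

lemma sum_list_cut: "(\<alpha>, \<beta>) \<in> cuts \<gamma> \<Longrightarrow> sum_list \<gamma> = sum_list \<alpha> + sum_list \<beta>"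
  by (auto simp: cuts_def sum_list_near_concat)

text \<open>
  The two kinds of cut differ only in whether the size of \<open>\<alpha>\<close> is itself a partial sum of \<open>\<gamma>\<close>. An
  empty \<open>\<alpha>\<close> or \<open>\<beta>\<close> has to be excluded there, since the sets omit \<open>0\<close> and the total size.
\<close>

lemma comp_set_cut:
  assumes "(\<alpha>, \<beta>) \<in> cuts \<gamma>"
  shows "i \<in> comp_set \<gamma> \<longleftrightarrow> i \<in> comp_set \<alpha> \<or> (\<exists>j\<in>comp_set \<beta>. i = sum_list \<alpha> + j) \<or>
    (i = sum_list \<alpha> \<and> \<alpha> @ \<beta> = \<gamma> \<and> \<alpha> \<noteq> [] \<and> \<beta> \<noteq> [])"
  using assms
proof (cases rule: cuts_cases)
  case concat
  then show ?thesis
    by (cases "\<alpha> = []"; cases "\<beta> = []") (auto simp: comp_set_append)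
next
  case near
  then show ?thesis
    by (auto simp: comp_set_near_concat)
qed

lemma comp_set_cut_left:
  assumes "(\<alpha>, \<beta>) \<in> cuts \<gamma>"
  shows "comp_set \<alpha> = {i \<in> comp_set \<gamma>. i < sum_list \<alpha>}"
  using comp_set_cut [OF assms] comp_set_subset [of \<alpha>] assms
  by (auto simp: cuts_def)

lemma comp_set_cut_right:
  assumes "(\<alpha>, \<beta>) \<in> cuts \<gamma>"
  shows "comp_set \<beta> = {j. 0 < j \<and> sum_list \<alpha> + j \<in> comp_set \<gamma>}"
  using comp_set_cut [OF assms] comp_set_subset [of \<alpha>] comp_set_subset [of \<beta>] assms
  by (fastforce simp: cuts_def)

text \<open>
  The sets of both members are determined by \<open>\<gamma>\<close> and the position of the cut, in the same way for
  concatenation and near-concatenation.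
\<close>

lemma cut_unique:
  assumes "(\<alpha>, \<beta>) \<in> cuts \<gamma>" "(\<alpha>', \<beta>') \<in> cuts \<gamma>" "sum_list \<alpha> = sum_list \<alpha>'"
  shows "(\<alpha>, \<beta>) = (\<alpha>', \<beta>')"
proof -
  have "sum_list \<beta> = sum_list \<beta>'"
    using sum_list_cut [OF assms(1)] sum_list_cut [OF assms(2)] assms(3) by simp
  then show ?thesis
    using assms comp_set_cut_left [OF assms(1)] comp_set_cut_left [OF assms(2)]
      comp_set_cut_right [OF assms(1)] comp_set_cut_right [OF assms(2)]
    by (auto simp: cuts_def intro!: comp_set_inject)
qed

lemma cut_exists:
  assumes "is_composition \<gamma>" "m \<le> sum_list \<gamma>"
  obtains \<alpha> \<beta> where "(\<alpha>, \<beta>) \<in> cuts \<gamma>" "sum_list \<alpha> = m"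
proof -
  have "\<exists>\<alpha> \<beta>. (\<alpha>, \<beta>) \<in> cuts \<gamma> \<and> sum_list \<alpha> = m"
    using assms
  proof (induction \<gamma> arbitrary: m)
    case Nil
    then show ?case
      by (auto simp: cuts_def)
  next
    case (Cons a \<gamma>)
    consider "m = 0" | "0 < m" "m < a" | "a \<le> m"
      by linarith
    then show ?case
    proof cases
      case 1
      then have "([], a # \<gamma>) \<in> cuts (a # \<gamma>) \<and> sum_list [] = m"
        using Cons.prems by (simp add: cuts_def)
      then show ?thesis
        by blast
    next
      case 2
      then have "([m], (a - m) # \<gamma>) \<in> cuts (a # \<gamma>) \<and> sum_list [m] = m"
        using Cons.prems by (simp add: cuts_def)
      then show ?thesis
        by blast
    next
      case 3
      with Cons obtain \<alpha> \<beta> where "(\<alpha>, \<beta>) \<in> cuts \<gamma>" "sum_list \<alpha> = m - a"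
        by (metis add_le_imp_le_diff diff_add_inverse is_composition_simps(2) le_add_diff_inverse
            nat_add_left_cancel_le sum_list.Cons)
      then have "(a # \<alpha>, \<beta>) \<in> cuts (a # \<gamma>) \<and> sum_list (a # \<alpha>) = m"
        using 3 Cons.prems
        by (cases "\<alpha> = []") (auto simp: cuts_def near_concat_Cons)
      then show ?thesis
        by blast
    qed
  qed
  then show thesis
    using that by blast
qed

text \<open>
  The position of the cut is a partial sum of \<open>\<mu> @ \<nu>\<close> unless \<open>\<mu>\<close> or \<open>\<nu>\<close> is empty, so the inclusion
  of sets can be tested separately before and after the cut.
\<close>

lemma append_refines_cut_iff:
  assumes cut: "(\<alpha>, \<beta>) \<in> cuts \<gamma>" and "is_composition \<gamma>"
    and \<mu>: "is_composition \<mu>" "sum_list \<mu> = sum_list \<alpha>"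
    and \<nu>: "is_composition \<nu>"
  shows "\<mu> @ \<nu> \<preceq> \<gamma> \<longleftrightarrow> \<mu> \<preceq> \<alpha> \<and> \<nu> \<preceq> \<beta>"
proof -
  have cut': "(\<mu>, \<nu>) \<in> cuts (\<mu> @ \<nu>)"
    using \<mu> \<nu> by (simp add: cuts_def)
  have comp: "is_composition \<alpha>" "is_composition \<beta>"
    using cut by (simp_all add: cuts_def)
  have sum: "sum_list \<gamma> = sum_list \<alpha> + sum_list \<beta>"
    using sum_list_cut [OF cut] .
  show ?thesis
  proof
    assume "\<mu> @ \<nu> \<preceq> \<gamma>"
    then have "comp_set \<gamma> \<subseteq> comp_set (\<mu> @ \<nu>)" "sum_list \<nu> = sum_list \<beta>"
      using sum \<mu>(2) by (simp_all add: refines_def)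
    then show "\<mu> \<preceq> \<alpha> \<and> \<nu> \<preceq> \<beta>"
      using comp \<mu> \<nu> unfolding refines_def comp_set_cut_left [OF cut] comp_set_cut_left [OF cut']
        comp_set_cut_right [OF cut] comp_set_cut_right [OF cut'] by auto
  next
    assume R: "\<mu> \<preceq> \<alpha> \<and> \<nu> \<preceq> \<beta>"
    then have sub: "comp_set \<alpha> \<subseteq> comp_set \<mu>" "comp_set \<beta> \<subseteq> comp_set \<nu>" "sum_list \<nu> = sum_list \<beta>"
      by (simp_all add: refines_def)
    have empty: "\<mu> = [] \<longleftrightarrow> \<alpha> = []" "\<nu> = [] \<longleftrightarrow> \<beta> = []"
      using comp \<mu> \<nu> sub(3) sum_list_eq_0_composition by metis+
    have "comp_set \<gamma> \<subseteq> comp_set (\<mu> @ \<nu>)"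
    proof
      fix i assume "i \<in> comp_set \<gamma>"
      then show "i \<in> comp_set (\<mu> @ \<nu>)"
        unfolding comp_set_cut [OF cut] comp_set_cut [OF cut'] \<mu>(2) empty using sub by blast
    qed
    then show "\<mu> @ \<nu> \<preceq> \<gamma>"
      using \<mu> \<nu> sum sub(3) \<open>is_composition \<gamma>\<close> by (simp add: refines_def)
  qed
qed

section \<open>The expansion of Hall--Littlewood functions in monomials\<close>

text \<open>
  For \<open>l = 0\<close> this is the coefficient of a monomial function in a Hall--Littlewood function. The shift
  \<open>l\<close> accounts for elements of a larger set that precede \<open>I\<close>, as after a cut.
\<close>

definition hl_weight :: "nat \<Rightarrow> nat set \<Rightarrow> nat set \<Rightarrow> ratfun" where
  "hl_weight l I K = (\<Prod>i\<in>K - I. 1 - q ^ (l + wt I i))"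

text \<open>
  Expanding the product of the binomials \<open>1 - q ^ wt I i\<close> amounts to choosing the subset of \<open>K - I\<close>
  where the second term is taken.
\<close>

lemma hl_weight_0_eq_alternating_sum:
  assumes "finite K" "I \<subseteq> K"
  shows "(\<Sum>J | I \<subseteq> J \<and> J \<subseteq> K. (- 1) ^ card (J - I) * q ^ (\<Sum>i\<in>J - I. wt I i)) = hl_weight 0 I K"
proof -
  have "hl_weight 0 I K = (\<Prod>i\<in>K - I. - (q ^ wt I i) + 1)"
    by (simp add: hl_weight_def)
  also have "\<dots> = (\<Sum>B\<in>Pow (K - I). (\<Prod>i\<in>B. - (q ^ wt I i)) * (\<Prod>i\<in>K - I - B. 1))"
    by (rule prod_add) (use assms in simp)
  also have "\<dots> = (\<Sum>B\<in>Pow (K - I). (- 1) ^ card B * q ^ (\<Sum>i\<in>B. wt I i))"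
    by (simp add: prod_uminus power_sum)
  also have "\<dots> = (\<Sum>J | I \<subseteq> J \<and> J \<subseteq> K. (- 1) ^ card (J - I) * q ^ (\<Sum>i\<in>J - I. wt I i))"
    by (rule sum.reindex_bij_witness [of _ "\<lambda>J. J - I" "\<lambda>B. B \<union> I"])
      (use assms(2) in \<open>auto intro!: arg_cong2 [where f = "(*)"] arg_cong [where f = "\<lambda>B. (-1) ^ card B"]
        arg_cong [where f = "\<lambda>B. q ^ sum (wt I) B"]\<close>)
  finally show ?thesis ..
qed

lemma G_qsym_eq_sum_M_qsym:
  "G_qsym \<alpha> = (\<Sum>\<kappa> | \<kappa> \<preceq> \<alpha>. qscale (hl_weight 0 (comp_set \<alpha>) (comp_set \<kappa>)) (M_qsym \<kappa>))"
proof -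
  interpret Q: vector_space qscale
    by (rule vector_space_qscale)
  define a where "a J = (- 1) ^ card (J - comp_set \<alpha>) *
    q ^ (\<Sum>i\<in>J - comp_set \<alpha>. wt (comp_set \<alpha>) i)" for J
  have "G_qsym \<alpha> =
      (\<Sum>\<beta> | \<beta> \<preceq> \<alpha>. \<Sum>\<kappa>\<in>{\<kappa> \<in> {\<kappa>. \<kappa> \<preceq> \<alpha>}. \<kappa> \<preceq> \<beta>}. qscale (a (comp_set \<beta>)) (M_qsym \<kappa>))"
    unfolding G_qsym_def
  proof (rule sum.cong [OF refl])
    fix \<beta> assume "\<beta> \<in> {\<beta>. \<beta> \<preceq> \<alpha>}"
    then have "{\<kappa> \<in> {\<kappa>. \<kappa> \<preceq> \<alpha>}. \<kappa> \<preceq> \<beta>} = {\<kappa>. \<kappa> \<preceq> \<beta>}" "\<beta> \<preceq> \<alpha>"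
      using refines_trans by auto
    then show "qscale ((- 1) ^ (length \<beta> - length \<alpha>) *
        q ^ (\<Sum>i\<in>comp_set \<beta> - comp_set \<alpha>. wt (comp_set \<alpha>) i)) (L_qsym \<beta>) =
        (\<Sum>\<kappa>\<in>{\<kappa> \<in> {\<kappa>. \<kappa> \<preceq> \<alpha>}. \<kappa> \<preceq> \<beta>}. qscale (a (comp_set \<beta>)) (M_qsym \<kappa>))"
      by (simp add: L_qsym_def Q.scale_sum_right a_def card_comp_set_Diff)
  qed
  also have "\<dots> = (\<Sum>\<kappa> | \<kappa> \<preceq> \<alpha>. \<Sum>\<beta>\<in>{\<beta> \<in> {\<beta>. \<beta> \<preceq> \<alpha>}. \<kappa> \<preceq> \<beta>}. qscale (a (comp_set \<beta>)) (M_qsym \<kappa>))"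
    by (rule sum.swap_restrict) simp_all
  also have "\<dots> = (\<Sum>\<kappa> | \<kappa> \<preceq> \<alpha>. qscale (hl_weight 0 (comp_set \<alpha>) (comp_set \<kappa>)) (M_qsym \<kappa>))"
  proof (rule sum.cong [OF refl])
    fix \<kappa> assume "\<kappa> \<in> {\<kappa>. \<kappa> \<preceq> \<alpha>}"
    then have \<kappa>: "\<kappa> \<preceq> \<alpha>"
      by simp
    have "(\<Sum>\<beta> | \<beta> \<preceq> \<alpha> \<and> \<kappa> \<preceq> \<beta>. a (comp_set \<beta>)) =
        (\<Sum>J | comp_set \<alpha> \<subseteq> J \<and> J \<subseteq> comp_set \<kappa>. a J)"
      by (rule sum.reindex_bij_betw [OF bij_betw_comp_set_interval [OF \<kappa>]])
    also have "\<dots> = hl_weight 0 (comp_set \<alpha>) (comp_set \<kappa>)"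
      unfolding a_def
      by (rule hl_weight_0_eq_alternating_sum) (use \<kappa> in \<open>simp_all add: refines_def\<close>)
    finally show "(\<Sum>\<beta>\<in>{\<beta> \<in> {\<beta>. \<beta> \<preceq> \<alpha>}. \<kappa> \<preceq> \<beta>}. qscale (a (comp_set \<beta>)) (M_qsym \<kappa>)) =
        qscale (hl_weight 0 (comp_set \<alpha>) (comp_set \<kappa>)) (M_qsym \<kappa>)"
      by (simp flip: Q.scale_sum_left)
  qed
  finally show ?thesis .
qed

lemma wt_cut_left:
  assumes "(\<alpha>, \<beta>) \<in> cuts \<gamma>" "i \<le> sum_list \<alpha>"
  shows "wt (comp_set \<gamma>) i = wt (comp_set \<alpha>) i"
proof -
  have "{1..i - 1} \<inter> comp_set \<gamma> = {1..i - 1} \<inter> comp_set \<alpha>"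
    unfolding comp_set_cut_left [OF assms(1)] using assms(2) by auto
  then show ?thesis
    by (simp add: wt_def)
qed

lemma wt_comp_set_sum_list:
  assumes "is_composition \<alpha>" "\<alpha> \<noteq> []"
  shows "wt (comp_set \<alpha>) (sum_list \<alpha>) = length \<alpha>"
proof -
  have "{1..sum_list \<alpha> - 1} \<inter> comp_set \<alpha> = comp_set \<alpha>"
    using comp_set_subset [OF assms(1)] by force
  then show ?thesis
    using assms by (simp add: wt_def card_comp_set Suc_leI)
qed

text \<open>
  For nonempty \<open>\<alpha>\<close>, the set of \<open>\<gamma>\<close> has \<open>length \<alpha> - 1\<close> elements before the cut, and it contains
  the cut itself only for a concatenation; an empty \<open>\<alpha>\<close> changes nothing.
\<close>

lemma wt_cut_right:
  assumes cut: "(\<alpha>, \<beta>) \<in> cuts \<gamma>" and j: "0 < j" "j < sum_list \<beta>"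
  shows "wt (comp_set \<gamma>) (sum_list \<alpha> + j) + of_bool (\<alpha> @ \<beta> \<noteq> \<gamma>) = length \<alpha> + wt (comp_set \<beta>) j"
proof -
  let ?m = "sum_list \<alpha>"
  have comp: "is_composition \<alpha>" and "\<beta> \<noteq> []"
    using cut j by (auto simp: cuts_def)
  let ?E = "{i. i = ?m \<and> \<alpha> @ \<beta> = \<gamma> \<and> \<alpha> \<noteq> []}"
  have bound: "i \<in> comp_set \<alpha> \<Longrightarrow> 0 < i \<and> i < ?m" for i
    using comp_set_subset [OF comp] by auto
  have bound': "i \<in> comp_set \<beta> \<Longrightarrow> 0 < i" for i
    using comp_set_subset [of \<beta>] cut by (auto simp: cuts_def)
  have "{1..?m + j - 1} \<inter> comp_set \<gamma> =
      comp_set \<alpha> \<union> (?E \<union> (+) ?m ` ({1..j - 1} \<inter> comp_set \<beta>))"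
    (is "?L = ?R")
  proof (rule set_eqI)
    fix i
    consider "i < ?m" | "i = ?m" | k where "0 < k" "i = ?m + k"
      by (metis less_imp_add_positive linorder_neqE_nat)
    then show "i \<in> ?L \<longleftrightarrow> i \<in> ?R"
    proof cases
      case 1
      then show ?thesis
        using j bound [of i] by (auto simp: comp_set_cut [OF cut])
    next
      case 2
      have "\<alpha> \<noteq> [] \<Longrightarrow> 0 < ?m"
        using sum_list_eq_0_composition [OF comp] by (metis gr0I)
      then show ?thesis
        using 2 j \<open>\<beta> \<noteq> []\<close> bound [of i] bound' [of 0] by (auto simp: comp_set_cut [OF cut])
    next
      case 3
      then show ?thesis
        using j bound [of i] by (auto simp: comp_set_cut [OF cut])
    qed
  qed
  moreover have "card (comp_set \<alpha> \<union> (?E \<union> (+) ?m ` ({1..j - 1} \<inter> comp_set \<beta>))) =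
      card (comp_set \<alpha>) + (card ?E + card ((+) ?m ` ({1..j - 1} \<inter> comp_set \<beta>)))"
    by (subst card_Un_disjoint, simp, simp, use bound in force)+ simp
  moreover have "card ?E = of_bool (\<alpha> @ \<beta> = \<gamma> \<and> \<alpha> \<noteq> [])"
    by auto
  moreover have "card ((+) ?m ` ({1..j - 1} \<inter> comp_set \<beta>)) = card ({1..j - 1} \<inter> comp_set \<beta>)"
    by (simp add: card_image)
  moreover have "\<alpha> = [] \<Longrightarrow> \<alpha> @ \<beta> = \<gamma>"
    using cut by (auto simp: cuts_def)
  moreover have "\<alpha> \<noteq> [] \<Longrightarrow> Suc (length \<alpha> - 1) = length \<alpha>"
    by simp
  ultimately show ?thesis
    unfolding wt_def card_comp_set [OF comp] by auto
qed

text \<open>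
  The weight of a position before the cut depends only on \<open>\<alpha>\<close>, and that of a position after it is
  the weight in \<open>\<beta>\<close> plus a constant.
\<close>

lemma hl_weight_cut:
  assumes cut: "(\<alpha>, \<beta>) \<in> cuts \<gamma>" and \<mu>: "\<mu> \<preceq> \<alpha>" and \<nu>: "\<nu> \<preceq> \<beta>"
  shows "hl_weight 0 (comp_set \<gamma>) (comp_set (\<mu> @ \<nu>)) = hl_weight 0 (comp_set \<alpha>) (comp_set \<mu>) *
    (if \<alpha> @ \<beta> = \<gamma> then hl_weight (length \<alpha>) (comp_set \<beta>) (comp_set \<nu>)
     else (1 - q ^ length \<alpha>) * hl_weight (length \<alpha> - 1) (comp_set \<beta>) (comp_set \<nu>))"
proof -
  let ?m = "sum_list \<alpha>" and ?f = "\<lambda>i. 1 - q ^ wt (comp_set \<gamma>) i"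
  let ?A = "comp_set \<mu> - comp_set \<alpha>" and ?B = "comp_set \<nu> - comp_set \<beta>"
  let ?E = "{i. i = ?m \<and> \<alpha> @ \<beta> \<noteq> \<gamma>}"
  have comp: "is_composition \<alpha>" "is_composition \<beta>" "is_composition \<mu>" "is_composition \<nu>"
    and sum: "sum_list \<mu> = ?m" "sum_list \<nu> = sum_list \<beta>"
    using \<mu> \<nu> by (simp_all add: refines_def)
  have cut': "(\<mu>, \<nu>) \<in> cuts (\<mu> @ \<nu>)"
    using comp by (simp add: cuts_def)
  have bound: "i \<in> comp_set \<mu> \<Longrightarrow> 0 < i \<and> i < ?m" "i \<in> comp_set \<alpha> \<Longrightarrow> 0 < i \<and> i < ?m"
    "i \<in> comp_set \<nu> \<Longrightarrow> 0 < i \<and> i < sum_list \<beta>" "i \<in> comp_set \<beta> \<Longrightarrow> 0 < i" for i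
    using comp_set_subset [OF comp(1)] comp_set_subset [OF comp(2)] comp_set_subset [OF comp(3)]
      comp_set_subset [OF comp(4)] sum by auto
  have empty: "\<mu> = [] \<longleftrightarrow> \<alpha> = []" "\<nu> = [] \<longleftrightarrow> \<beta> = []"
    using comp sum sum_list_eq_0_composition by metis+
  have near: "\<alpha> \<noteq> [] \<and> \<beta> \<noteq> []" if "\<alpha> @ \<beta> \<noteq> \<gamma>"
    using cut that by (cases rule: cuts_cases) auto
  \<comment> \<open>In a near-concatenation the cut is a new partial sum, and it has weight \<open>length \<alpha>\<close>.\<close>
  have "comp_set (\<mu> @ \<nu>) - comp_set \<gamma> = ?A \<union> (?E \<union> (+) ?m ` ?B)"
  proof (rule set_eqI)
    fix i
    consider "i < ?m" | "i = ?m" | j where "0 < j" "i = ?m + j"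
      by (metis less_imp_add_positive linorder_neqE_nat)
    then show "i \<in> comp_set (\<mu> @ \<nu>) - comp_set \<gamma> \<longleftrightarrow> i \<in> ?A \<union> (?E \<union> (+) ?m ` ?B)"
    proof cases
      case 1
      then show ?thesis
        by (auto simp: comp_set_cut [OF cut] comp_set_cut [OF cut'] sum)
    next
      case 2
      then show ?thesis
        using bound(1,2) [of i] bound(3,4) [of 0] near empty
        by (auto simp: comp_set_cut [OF cut] comp_set_cut [OF cut'] sum)
    next
      case 3
      then show ?thesis
        using bound(1,2) [of i]
        by (auto simp: comp_set_cut [OF cut] comp_set_cut [OF cut'] sum)
    qed
  qed
  moreover have "prod ?f (?A \<union> (?E \<union> (+) ?m ` ?B)) = prod ?f ?A * (prod ?f ?E * prod ?f ((+) ?m ` ?B))"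
    by (subst prod.union_disjoint, simp, simp, use bound in force)+ simp
  moreover have "prod ?f ?A = hl_weight 0 (comp_set \<alpha>) (comp_set \<mu>)"
    unfolding hl_weight_def
    by (rule prod.cong) (use bound(1) wt_cut_left [OF cut] in \<open>auto simp: less_imp_le\<close>)
  moreover have "prod ?f ?E = (if \<alpha> @ \<beta> = \<gamma> then 1 else 1 - q ^ length \<alpha>)"
    using near wt_comp_set_sum_list [OF comp(1)] wt_cut_left [OF cut, of ?m] by simp
  moreover have "prod ?f ((+) ?m ` ?B) =
      hl_weight (if \<alpha> @ \<beta> = \<gamma> then length \<alpha> else length \<alpha> - 1) (comp_set \<beta>) (comp_set \<nu>)"
    unfolding hl_weight_def
  proof (subst prod.reindex, simp, rule prod.cong [OF refl])
    fix j assume "j \<in> ?B"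
    then have "wt (comp_set \<gamma>) (?m + j) + of_bool (\<alpha> @ \<beta> \<noteq> \<gamma>) = length \<alpha> + wt (comp_set \<beta>) j"
      using bound(3) wt_cut_right [OF cut] by auto
    moreover have "Suc (length \<alpha> - 1) = length \<alpha>" if "\<alpha> @ \<beta> \<noteq> \<gamma>"
      using near [OF that] by simp
    ultimately have "wt (comp_set \<gamma>) (?m + j) =
        (if \<alpha> @ \<beta> = \<gamma> then length \<alpha> else length \<alpha> - 1) + wt (comp_set \<beta>) j"
      by (auto split: if_splits)
    then show "(?f \<circ> (+) ?m) j =
        1 - q ^ ((if \<alpha> @ \<beta> = \<gamma> then length \<alpha> else length \<alpha> - 1) + wt (comp_set \<beta>) j)"
      by simp
  qed
  ultimately show ?thesis
    unfolding hl_weight_def [of 0 "comp_set \<gamma>"] by simp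
qed

section \<open>Shifting the weights\<close>

lemma c_coeff_0 [simp]: "c_coeff u 0 = 1"
  by (simp add: c_coeff_def)

lemma c_coeff_Suc: "c_coeff u (Suc v) = c_coeff u v * (1 - q ^ (u - v))"
  by (cases "v = u") (auto simp: c_coeff_def)

lemma c_coeff_eq_0: "u < v \<Longrightarrow> c_coeff u v = 0"
  by (simp add: c_coeff_def)

lemma c_coeff_Suc_Suc: "c_coeff (Suc u) (Suc v) = (1 - q ^ Suc u) * c_coeff u v"
  by (simp add: c_coeff_def prod.lessThan_Suc_shift del: prod.lessThan_Suc)

lemma wt_insert_ge: "i \<le> m \<Longrightarrow> wt (insert m I) i = wt I i"
  unfolding wt_def by (cases "i = 0") (auto intro!: arg_cong [where f = card])

lemma wt_greater_all:
  assumes "\<forall>i\<in>I. 0 < i \<and> i < m"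
  shows "wt I m = Suc (card I)"
proof -
  have "{1..m - 1} \<inter> I = I"
    using assms by force
  then show ?thesis
    by (simp add: wt_def)
qed

text \<open>
  The largest element \<open>m\<close> of \<open>K\<close> does not influence the weights of the others. If it lies in \<open>I\<close>, it
  can be dropped everywhere. Otherwise it contributes \<open>1 - q ^ (l + card I + 1)\<close> to the left-hand
  side. On the right, the terms of \<open>J\<close> and \<open>insert m J\<close>, for \<open>J \<subseteq> K - {m}\<close>, add up to the term
  of \<open>J\<close> for \<open>K - {m}\<close>, times \<open>1 - q ^ (card J + 1) + q ^ (card J + 1) * (1 - q ^ (l - s))\<close> with
  \<open>s = card (J - I)\<close>. As \<open>card J = card I + s\<close>, this telescopes to the same factor, whatever \<open>J\<close> is.
\<close>

lemma hl_weight_shift: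
  assumes "finite K" "0 \<notin> K" "I \<subseteq> K"
  shows "hl_weight l I K = (\<Sum>J | I \<subseteq> J \<and> J \<subseteq> K.
    q ^ (\<Sum>j\<in>J - I. wt J j) * c_coeff l (card (J - I)) * hl_weight 0 J K)"
  using assms
proof (induction K arbitrary: I rule: finite_linorder_max_induct)
  case empty
  then have "{J. I \<subseteq> J \<and> J \<subseteq> {}} = {{}}"
    by auto
  with empty show ?case
    by (simp add: hl_weight_def)
next
  case (insert m K)
  let ?T = "\<lambda>I J K. q ^ (\<Sum>j\<in>J - I. wt J j) * c_coeff l (card (J - I)) * hl_weight 0 J K"
  have m: "m \<notin> K"
    using insert.hyps(2) by blast
  have wt_insert: "wt (insert m J) j = wt J j" if "j \<in> K" for j J
    using insert.hyps(2) that by (simp add: wt_insert_ge less_imp_le)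
  have hl_insert: "hl_weight l' (insert m J) (insert m K) = hl_weight l' J K" for l' J
  proof -
    have "insert m K - insert m J = K - J"
      using m by auto
    then show ?thesis
      by (simp add: hl_weight_def wt_insert)
  qed
  have inj: "inj_on (insert m) {J. I \<subseteq> J \<and> J \<subseteq> K}" for I
    using m by (auto simp: inj_on_def)
  show ?case
  proof (cases "m \<in> I")
    case True
    define I' where "I' = I - {m}"
    have I: "I = insert m I'" "I' \<subseteq> K" "m \<notin> I'"
      using True insert.prems by (auto simp: I'_def)
    have "{J. I \<subseteq> J \<and> J \<subseteq> insert m K} = insert m ` {J. I' \<subseteq> J \<and> J \<subseteq> K}"
    proof (intro equalityI subsetI)
      fix J assume "J \<in> {J. I \<subseteq> J \<and> J \<subseteq> insert m K}"
      then show "J \<in> insert m ` {J. I' \<subseteq> J \<and> J \<subseteq> K}"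
        using I by (intro image_eqI [of _ _ "J - {m}"]) auto
    qed (use I in auto)
    then have "(\<Sum>J | I \<subseteq> J \<and> J \<subseteq> insert m K. ?T I J (insert m K)) =
        (\<Sum>J | I' \<subseteq> J \<and> J \<subseteq> K. ?T I (insert m J) (insert m K))"
      by (simp add: sum.reindex [OF inj])
    also have "\<dots> = (\<Sum>J | I' \<subseteq> J \<and> J \<subseteq> K. ?T I' J K)"
    proof (rule sum.cong [OF refl])
      fix J assume "J \<in> {J. I' \<subseteq> J \<and> J \<subseteq> K}"
      then have "insert m J - I = J - I'" "J - I' \<subseteq> K"
        using m by (auto simp: I)
      moreover from this have "(\<Sum>j\<in>J - I'. wt (insert m J) j) = (\<Sum>j\<in>J - I'. wt J j)"
        by (intro sum.cong refl wt_insert) auto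
      ultimately show "?T I (insert m J) (insert m K) = ?T I' J K"
        by (simp add: hl_insert)
    qed
    also have "\<dots> = hl_weight l I' K"
      using insert I by simp
    finally show ?thesis
      by (simp add: I hl_insert)
  next
    case False
    then have I: "I \<subseteq> K"
      using insert.prems by auto
    then have fin: "finite I"
      using insert.hyps(1) finite_subset by blast
    have hl_new: "hl_weight l' J (insert m K) = (1 - q ^ (l' + Suc (card J))) * hl_weight l' J K"
      if "J \<subseteq> K" for l' J
    proof -
      have "insert m K - J = insert m (K - J)"
        using m that by auto
      moreover have "wt J m = Suc (card J)"
        by (rule wt_greater_all) (use that insert.hyps(2) insert.prems in \<open>metis gr0I insertCI subsetD\<close>)
      ultimately show ?thesis
        using m insert.hyps(1) by (simp add: hl_weight_def)
    qed
    have "{J. I \<subseteq> J \<and> J \<subseteq> insert m K} = {J. I \<subseteq> J \<and> J \<subseteq> K} \<union> insert m ` {J. I \<subseteq> J \<and> J \<subseteq> K}"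
    proof (intro equalityI subsetI)
      fix J assume J: "J \<in> {J. I \<subseteq> J \<and> J \<subseteq> insert m K}"
      show "J \<in> {J. I \<subseteq> J \<and> J \<subseteq> K} \<union> insert m ` {J. I \<subseteq> J \<and> J \<subseteq> K}"
      proof (cases "m \<in> J")
        case True
        then have "J = insert m (J - {m})" "J - {m} \<in> {J. I \<subseteq> J \<and> J \<subseteq> K}"
          using J False by auto
        then show ?thesis
          by blast
      qed (use J in auto)
    qed (use I in auto)
    moreover have "{J. I \<subseteq> J \<and> J \<subseteq> K} \<inter> insert m ` {J. I \<subseteq> J \<and> J \<subseteq> K} = {}"
      using m by auto
    moreover have "finite {J. I \<subseteq> J \<and> J \<subseteq> K}"
      by (rule finite_subset [of _ "Pow K"]) (use insert.hyps(1) in auto)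
    ultimately have "(\<Sum>J | I \<subseteq> J \<and> J \<subseteq> insert m K. ?T I J (insert m K)) =
        (\<Sum>J | I \<subseteq> J \<and> J \<subseteq> K. ?T I J (insert m K) + ?T I (insert m J) (insert m K))"
      by (simp add: sum.union_disjoint sum.reindex [OF inj] sum.distrib)
    also have "\<dots> = (\<Sum>J | I \<subseteq> J \<and> J \<subseteq> K. (1 - q ^ (l + Suc (card I))) * ?T I J K)"
    proof (rule sum.cong [OF refl])
      fix J assume "J \<in> {J. I \<subseteq> J \<and> J \<subseteq> K}"
      then have J: "I \<subseteq> J" "J \<subseteq> K" "finite J"
        using insert.hyps(1) finite_subset by auto
      define s where "s = card (J - I)"
      define w where "w = (\<Sum>j\<in>J - I. wt J j)"
      have card_J: "card J = card I + s"
        using J fin by (simp add: s_def card_Diff_subset card_mono)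
      have "insert m J - I = insert m (J - I)" "m \<notin> J - I"
        using False m J by auto
      moreover have "wt (insert m J) m = Suc (card J)"
        unfolding wt_insert_ge [OF order_refl]
        by (rule wt_greater_all) (use J insert.hyps(2) insert.prems in \<open>metis gr0I insertCI subsetD\<close>)
      moreover have "(\<Sum>j\<in>J - I. wt (insert m J) j) = w"
        unfolding w_def by (rule sum.cong [OF refl]) (use J wt_insert in auto)
      ultimately have new: "?T I (insert m J) (insert m K) =
          q ^ (Suc (card J) + w) * c_coeff l (Suc s) * hl_weight 0 J K"
        using J by (simp add: hl_insert s_def)
      \<comment> \<open>For \<open>s > l\<close> the difference \<open>l - s\<close> is truncated, but then \<open>c_coeff l s\<close> vanishes.\<close>
      have "c_coeff l s * (1 - q ^ Suc (card J)) + q ^ Suc (card J) * c_coeff l (Suc s) =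
          c_coeff l s * (1 - q ^ (l + Suc (card I)))"
      proof (cases "s \<le> l")
        case True
        then have "Suc (card J) + (l - s) = l + Suc (card I)"
          by (simp add: card_J)
        then have "q ^ Suc (card J) * q ^ (l - s) = q ^ (l + Suc (card I))"
          by (metis power_add)
        then show ?thesis
          unfolding c_coeff_Suc by (simp add: algebra_simps del: power_Suc)
      next
        case False
        then show ?thesis
          by (simp add: c_coeff_eq_0)
      qed
      then have "q ^ w * hl_weight 0 J K *
          (c_coeff l s * (1 - q ^ Suc (card J)) + q ^ Suc (card J) * c_coeff l (Suc s)) =
          q ^ w * hl_weight 0 J K * (c_coeff l s * (1 - q ^ (l + Suc (card I))))"
        by simp
      then show "?T I J (insert m K) + ?T I (insert m J) (insert m K) =
          (1 - q ^ (l + Suc (card I))) * ?T I J K"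
        unfolding new hl_new [OF J(2)] power_add
        by (simp add: s_def [symmetric] w_def [symmetric] algebra_simps del: power_Suc)
    qed
    also have "\<dots> = (1 - q ^ (l + Suc (card I))) * hl_weight l I K"
      unfolding sum_distrib_left [symmetric] using insert I by simp
    also have "\<dots> = hl_weight l I (insert m K)"
      by (simp add: hl_new [OF I])
    finally show ?thesis ..
  qed
qed

text \<open>
  The element of \<open>S\<close> at place \<open>k\<close>, counted from one, has \<open>k - 1\<close> smaller elements of \<open>S\<close>, hence
  weight \<open>k\<close>.
\<close>

lemma sum_ranks_eq_sum_wt:
  assumes "finite S" "0 \<notin> S"
  shows "(\<Sum>k | k \<in> {1..length (sorted_list_of_set S)} \<and> sorted_list_of_set S ! (k - 1) \<notin> T. k) =
    (\<Sum>j\<in>S - T. wt S j)"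
proof -
  define js where "js = sorted_list_of_set S"
  have js: "set js = S" "distinct js" "sorted_wrt (<) js"
    using assms(1) by (simp_all add: js_def)
  have wt: "wt S (js ! i) = Suc i" if "i < length js" for i
  proof -
    have "{1..js ! i - 1} \<inter> S = (!) js ` {..<i}"
    proof (intro equalityI subsetI)
      fix x assume x: "x \<in> {1..js ! i - 1} \<inter> S"
      then obtain k where k: "k < length js" "x = js ! k"
        using js(1) by (metis IntD2 in_set_conv_nth)
      moreover have "x < js ! i"
        using x by auto
      ultimately have "k < i"
        using js(3) that by (metis linorder_neqE_nat not_less_iff_gr_or_eq sorted_wrt_nth_less)
      then show "x \<in> (!) js ` {..<i}"
        using k by blast
    next
      fix x assume "x \<in> (!) js ` {..<i}"
      then obtain k where k: "k < i" "x = js ! k"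
        by blast
      then have "x < js ! i" "x \<in> S"
        using that js by (auto simp: sorted_wrt_nth_less)
      moreover have "x \<noteq> 0"
        using \<open>x \<in> S\<close> assms(2) by metis
      ultimately show "x \<in> {1..js ! i - 1} \<inter> S"
        by auto
    qed
    moreover have "inj_on ((!) js) {..<i}"
      by (rule inj_on_nth) (use js(2) that in auto)
    ultimately show ?thesis
      by (simp add: wt_def card_image)
  qed
  have "bij_betw (\<lambda>k. js ! (k - 1)) {k. k \<in> {1..length js} \<and> js ! (k - 1) \<notin> T} (S - T)"
  proof (rule bij_betw_imageI)
    show "inj_on (\<lambda>k. js ! (k - 1)) {k. k \<in> {1..length js} \<and> js ! (k - 1) \<notin> T}"
      using js(2) by (auto simp: inj_on_def nth_eq_iff_index_eq)
    show "(\<lambda>k. js ! (k - 1)) ` {k. k \<in> {1..length js} \<and> js ! (k - 1) \<notin> T} = S - T"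
    proof (intro equalityI subsetI)
      fix x assume x: "x \<in> S - T"
      then obtain k where "k < length js" "x = js ! k"
        using js(1) by (metis DiffD1 in_set_conv_nth)
      then show "x \<in> (\<lambda>k. js ! (k - 1)) ` {k. k \<in> {1..length js} \<and> js ! (k - 1) \<notin> T}"
        using x by (intro image_eqI [of _ _ "Suc k"]) auto
    qed (use js(1) in auto)
  qed
  then have "(\<Sum>j\<in>S - T. wt S j) =
      (\<Sum>k | k \<in> {1..length js} \<and> js ! (k - 1) \<notin> T. wt S (js ! (k - 1)))"
    by (rule sum.reindex_bij_betw [symmetric])
  also have "\<dots> = (\<Sum>k | k \<in> {1..length js} \<and> js ! (k - 1) \<notin> T. k)"
    by (rule sum.cong) (auto simp: wt)
  finally show ?thesis
    by (simp add: js_def)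
qed

lemma g_exp_eq_sum_wt:
  assumes "is_composition \<beta>'"
  shows "g_exp \<beta> \<beta>' = (\<Sum>j\<in>comp_set \<beta>' - comp_set \<beta>. wt (comp_set \<beta>') j)"
  unfolding g_exp_def Let_def
  by (rule sum_ranks_eq_sum_wt) (use comp_set_subset [OF assms] in auto)

lemma hl_weight_shift_compositions:
  assumes "\<nu> \<preceq> \<beta>"
  shows "hl_weight l (comp_set \<beta>) (comp_set \<nu>) = (\<Sum>\<beta>' | \<beta>' \<preceq> \<beta> \<and> \<nu> \<preceq> \<beta>'.
    q ^ g_exp \<beta> \<beta>' * c_coeff l (length \<beta>' - length \<beta>) * hl_weight 0 (comp_set \<beta>') (comp_set \<nu>))"
proof -
  have "0 \<notin> comp_set \<nu>" "comp_set \<beta> \<subseteq> comp_set \<nu>"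
    using assms comp_set_subset [of \<nu>] by (auto simp: refines_def)
  then have "hl_weight l (comp_set \<beta>) (comp_set \<nu>) =
      (\<Sum>\<beta>' | \<beta>' \<preceq> \<beta> \<and> \<nu> \<preceq> \<beta>'.
        q ^ (\<Sum>j\<in>comp_set \<beta>' - comp_set \<beta>. wt (comp_set \<beta>') j) *
        c_coeff l (card (comp_set \<beta>' - comp_set \<beta>)) * hl_weight 0 (comp_set \<beta>') (comp_set \<nu>))"
    unfolding hl_weight_shift [OF finite_comp_set \<open>0 \<notin> comp_set \<nu>\<close> \<open>comp_set \<beta> \<subseteq> comp_set \<nu>\<close>]
    by (intro sum.reindex_bij_betw [OF bij_betw_comp_set_interval [OF assms], symmetric])
  also have "\<dots> = (\<Sum>\<beta>' | \<beta>' \<preceq> \<beta> \<and> \<nu> \<preceq> \<beta>'.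
      q ^ g_exp \<beta> \<beta>' * c_coeff l (length \<beta>' - length \<beta>) * hl_weight 0 (comp_set \<beta>') (comp_set \<nu>))"
    by (rule sum.cong) (auto simp: g_exp_eq_sum_wt card_comp_set_Diff refines_def)
  finally show ?thesis .
qed

text \<open>
  The equality of the coefficients of \<open>M_qsym \<mu> \<otimes> M_qsym \<nu>\<close> on the two sides of the theorem. For a
  concatenation the weights are shifted by \<open>length \<alpha>\<close>. For a near-concatenation they are shifted by
  one less, and the factor of the cut completes \<open>c_coeff\<close> by \<open>c_coeff_Suc_Suc\<close>.
\<close>

lemma hl_weight_cut_eq_sum:
  assumes cut: "(\<alpha>, \<beta>) \<in> cuts \<gamma>" and \<mu>: "\<mu> \<preceq> \<alpha>" and \<nu>: "\<nu> \<preceq> \<beta>"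
  shows "hl_weight 0 (comp_set \<gamma>) (comp_set (\<mu> @ \<nu>)) = (\<Sum>\<beta>' | \<beta>' \<preceq> \<beta> \<and> \<nu> \<preceq> \<beta>'.
    q ^ g_exp \<beta> \<beta>' * d_coeff \<alpha> \<beta> \<beta>' \<gamma> *
    (hl_weight 0 (comp_set \<alpha>) (comp_set \<mu>) * hl_weight 0 (comp_set \<beta>') (comp_set \<nu>)))"
  using cut
proof (cases rule: cuts_cases)
  case concat
  then show ?thesis
    by (simp add: hl_weight_cut [OF assms] hl_weight_shift_compositions [OF \<nu>] d_coeff_def
        sum_distrib_left mult_ac)
next
  case near
  then obtain l where l: "length \<alpha> = Suc l"
    by (cases \<alpha>) auto
  show ?thesis
    using near(2)
    by (simp add: hl_weight_cut [OF assms] hl_weight_shift_compositions [OF \<nu>] d_coeff_def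
        sum_distrib_left mult_ac l c_coeff_Suc_Suc del: power_Suc)
qed

section \<open>The coproduct\<close>

lemma tensor_zero_left [simp]: "0 \<otimes> g = 0"
  using tensor_add_left [of 0 0 g] by simp

lemma tensor_zero_right [simp]: "f \<otimes> 0 = 0"
  using tensor_add_right [of f 0 0] by simp

lemma tensor_sum_left: "sum f A \<otimes> g = (\<Sum>x\<in>A. f x \<otimes> g)"
  by (induction A rule: infinite_finite_induct) (simp_all add: tensor_add_left)

lemma tensor_sum_right: "f \<otimes> sum g A = (\<Sum>x\<in>A. f \<otimes> g x)"
  by (induction A rule: infinite_finite_induct) (simp_all add: tensor_add_right)

lemma finite_refining_pairs:
  "finite {(\<mu>, \<nu>). is_composition \<mu> \<and> is_composition \<nu> \<and> \<mu> @ \<nu> \<preceq> \<gamma>}"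
  by (rule finite_subset [of _ "{\<mu>. is_composition \<mu> \<and> sum_list \<mu> \<le> sum_list \<gamma>} \<times>
        {\<nu>. is_composition \<nu> \<and> sum_list \<nu> \<le> sum_list \<gamma>}"])
    (auto simp: refines_def finite_compositions)

lemma coproduct_G_qsym_eq_sum_M_qsym:
  "\<triangle> (G_qsym \<gamma>) = (\<Sum>(\<mu>, \<nu>) | is_composition \<mu> \<and> is_composition \<nu> \<and> \<mu> @ \<nu> \<preceq> \<gamma>.
    tscale (hl_weight 0 (comp_set \<gamma>) (comp_set (\<mu> @ \<nu>))) (M_qsym \<mu> \<otimes> M_qsym \<nu>))"
proof -
  interpret T: vector_space tscale
    by (rule vector_space_tscale)
  interpret D: Vector_Spaces.linear qscale tscale \<triangle>
    using is_coproduct_coproduct by (simp add: is_coproduct_def)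
  let ?h = "\<lambda>\<kappa>. hl_weight 0 (comp_set \<gamma>) (comp_set \<kappa>)"
  let ?P = "{(\<mu>, \<nu>). is_composition \<mu> \<and> is_composition \<nu> \<and> \<mu> @ \<nu> \<preceq> \<gamma>}"
  have "\<triangle> (G_qsym \<gamma>) = (\<Sum>\<kappa> | \<kappa> \<preceq> \<gamma>. tscale (?h \<kappa>) (\<triangle> (M_qsym \<kappa>)))"
    unfolding G_qsym_eq_sum_M_qsym by (simp add: D.sum D.scale)
  also have "\<dots> = (\<Sum>\<kappa> | \<kappa> \<preceq> \<gamma>. \<Sum>x\<in>{x \<in> ?P. (case x of (\<mu>, \<nu>) \<Rightarrow> \<mu> @ \<nu>) = \<kappa>}.
      case x of (\<mu>, \<nu>) \<Rightarrow> tscale (?h (\<mu> @ \<nu>)) (M_qsym \<mu> \<otimes> M_qsym \<nu>))"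
  proof (rule sum.cong [OF refl])
    fix \<kappa> assume \<kappa>: "\<kappa> \<in> {\<kappa>. \<kappa> \<preceq> \<gamma>}"
    then have "\<triangle> (M_qsym \<kappa>) =
        (\<Sum>(\<mu>, \<nu>) | is_composition \<mu> \<and> is_composition \<nu> \<and> \<mu> @ \<nu> = \<kappa>. M_qsym \<mu> \<otimes> M_qsym \<nu>)"
      using is_coproduct_coproduct by (simp add: is_coproduct_def refines_def)
    then show "tscale (?h \<kappa>) (\<triangle> (M_qsym \<kappa>)) =
        (\<Sum>x\<in>{x \<in> ?P. (case x of (\<mu>, \<nu>) \<Rightarrow> \<mu> @ \<nu>) = \<kappa>}.
          case x of (\<mu>, \<nu>) \<Rightarrow> tscale (?h (\<mu> @ \<nu>)) (M_qsym \<mu> \<otimes> M_qsym \<nu>))"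
      using \<kappa> by (auto simp: T.scale_sum_right intro!: sum.cong)
  qed
  also have "\<dots> = (\<Sum>(\<mu>, \<nu>)\<in>?P. tscale (?h (\<mu> @ \<nu>)) (M_qsym \<mu> \<otimes> M_qsym \<nu>))"
    by (rule sum.group) (use finite_refining_pairs in auto)
  finally show ?thesis .
qed

text \<open>
  The pair \<open>(\<mu>, \<nu>)\<close> belongs to the cut of \<open>\<gamma>\<close> at the size of \<open>\<mu>\<close>. With \<open>cut_unique\<close> the union is
  disjoint, which sorts the terms of the coproduct by the cuts of \<open>\<gamma>\<close>.
\<close>

lemma refining_pairs_eq_UN_cuts:
  assumes "is_composition \<gamma>"
  shows "{(\<mu>, \<nu>). is_composition \<mu> \<and> is_composition \<nu> \<and> \<mu> @ \<nu> \<preceq> \<gamma>} =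
    (\<Union>(\<alpha>, \<beta>)\<in>cuts \<gamma>. {\<mu>. \<mu> \<preceq> \<alpha>} \<times> {\<nu>. \<nu> \<preceq> \<beta>})" (is "?P = ?U")
proof (intro equalityI subrelI)
  fix \<mu> \<nu> assume "(\<mu>, \<nu>) \<in> ?P"
  then have *: "is_composition \<mu>" "is_composition \<nu>" "\<mu> @ \<nu> \<preceq> \<gamma>"
    by auto
  then have "sum_list \<mu> \<le> sum_list \<gamma>"
    by (auto simp: refines_def)
  with assms obtain \<alpha> \<beta> where cut: "(\<alpha>, \<beta>) \<in> cuts \<gamma>" "sum_list \<alpha> = sum_list \<mu>"
    by (rule cut_exists)
  then have "\<mu> \<preceq> \<alpha> \<and> \<nu> \<preceq> \<beta>"
    using append_refines_cut_iff [OF cut(1) assms *(1) _ *(2)] * by simp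
  then show "(\<mu>, \<nu>) \<in> ?U"
    using cut by auto
next
  fix \<mu> \<nu> assume "(\<mu>, \<nu>) \<in> ?U"
  then obtain \<alpha> \<beta> where cut: "(\<alpha>, \<beta>) \<in> cuts \<gamma>" and "\<mu> \<preceq> \<alpha>" "\<nu> \<preceq> \<beta>"
    by auto
  then show "(\<mu>, \<nu>) \<in> ?P"
    using append_refines_cut_iff [OF cut assms, of \<mu> \<nu>] by (simp add: refines_def)
qed

lemma finite_cuts: "finite (cuts \<gamma>)"
  by (rule finite_subset [of _ "{\<mu>. is_composition \<mu> \<and> sum_list \<mu> \<le> sum_list \<gamma>} \<times>
        {\<nu>. is_composition \<nu> \<and> sum_list \<nu> \<le> sum_list \<gamma>}"])
    (auto simp: cuts_def finite_compositions sum_list_near_concat)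

lemma sum_tensor_G_qsym_eq_sum_M_qsym:
  assumes cut: "(\<alpha>, \<beta>) \<in> cuts \<gamma>"
  shows "(\<Sum>\<beta>' | \<beta>' \<preceq> \<beta>. tscale (q ^ g_exp \<beta> \<beta>' * d_coeff \<alpha> \<beta> \<beta>' \<gamma>) (G_qsym \<alpha> \<otimes> G_qsym \<beta>')) =
    (\<Sum>(\<mu>, \<nu>)\<in>{\<mu>. \<mu> \<preceq> \<alpha>} \<times> {\<nu>. \<nu> \<preceq> \<beta>}.
      tscale (hl_weight 0 (comp_set \<gamma>) (comp_set (\<mu> @ \<nu>))) (M_qsym \<mu> \<otimes> M_qsym \<nu>))"
proof -
  interpret T: vector_space tscale
    by (rule vector_space_tscale)
  let ?h = "\<lambda>\<alpha> \<mu>. hl_weight 0 (comp_set \<alpha>) (comp_set \<mu>)"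
  let ?c = "\<lambda>\<beta>'. q ^ g_exp \<beta> \<beta>' * d_coeff \<alpha> \<beta> \<beta>' \<gamma>"
  let ?t = "\<lambda>\<beta>' \<mu> \<nu>. tscale (?c \<beta>' * (?h \<alpha> \<mu> * ?h \<beta>' \<nu>)) (M_qsym \<mu> \<otimes> M_qsym \<nu>)"
  have "(\<Sum>\<beta>' | \<beta>' \<preceq> \<beta>. tscale (?c \<beta>') (G_qsym \<alpha> \<otimes> G_qsym \<beta>')) =
      (\<Sum>\<beta>' | \<beta>' \<preceq> \<beta>. \<Sum>\<nu>\<in>{\<nu> \<in> {\<nu>. \<nu> \<preceq> \<beta>}. \<nu> \<preceq> \<beta>'}. \<Sum>\<mu> | \<mu> \<preceq> \<alpha>. ?t \<beta>' \<mu> \<nu>)"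
  proof (rule sum.cong [OF refl])
    fix \<beta>' assume "\<beta>' \<in> {\<beta>'. \<beta>' \<preceq> \<beta>}"
    then have "{\<nu> \<in> {\<nu>. \<nu> \<preceq> \<beta>}. \<nu> \<preceq> \<beta>'} = {\<nu>. \<nu> \<preceq> \<beta>'}"
      using refines_trans by auto
    then show "tscale (?c \<beta>') (G_qsym \<alpha> \<otimes> G_qsym \<beta>') =
        (\<Sum>\<nu>\<in>{\<nu> \<in> {\<nu>. \<nu> \<preceq> \<beta>}. \<nu> \<preceq> \<beta>'}. \<Sum>\<mu> | \<mu> \<preceq> \<alpha>. ?t \<beta>' \<mu> \<nu>)"
      by (simp add: G_qsym_eq_sum_M_qsym tensor_sum_left tensor_sum_right tensor_scale_left
          tensor_scale_right T.scale_sum_right mult_ac)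
  qed
  also have "\<dots> = (\<Sum>\<nu> | \<nu> \<preceq> \<beta>. \<Sum>\<beta>'\<in>{\<beta>' \<in> {\<beta>'. \<beta>' \<preceq> \<beta>}. \<nu> \<preceq> \<beta>'}. \<Sum>\<mu> | \<mu> \<preceq> \<alpha>. ?t \<beta>' \<mu> \<nu>)"
    by (rule sum.swap_restrict) simp_all
  also have "\<dots> = (\<Sum>\<nu> | \<nu> \<preceq> \<beta>. \<Sum>\<mu> | \<mu> \<preceq> \<alpha>. \<Sum>\<beta>'\<in>{\<beta>'. \<beta>' \<preceq> \<beta> \<and> \<nu> \<preceq> \<beta>'}. ?t \<beta>' \<mu> \<nu>)"
    by (subst sum.swap) simp
  also have "\<dots> = (\<Sum>\<mu> | \<mu> \<preceq> \<alpha>. \<Sum>\<nu> | \<nu> \<preceq> \<beta>. \<Sum>\<beta>'\<in>{\<beta>'. \<beta>' \<preceq> \<beta> \<and> \<nu> \<preceq> \<beta>'}. ?t \<beta>' \<mu> \<nu>)"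
    by (rule sum.swap)
  also have "\<dots> = (\<Sum>\<mu> | \<mu> \<preceq> \<alpha>. \<Sum>\<nu> | \<nu> \<preceq> \<beta>. tscale (?h \<gamma> (\<mu> @ \<nu>)) (M_qsym \<mu> \<otimes> M_qsym \<nu>))"
    by (intro sum.cong refl) (simp add: hl_weight_cut_eq_sum [OF cut] T.scale_sum_left)
  finally show ?thesis
    by (simp add: sum.cartesian_product)
qed

theorem theorem5p8:
  fixes \<gamma> :: "nat list"
  assumes "is_composition \<gamma>"
  shows "\<triangle> (G_qsym \<gamma>) =
    (\<Sum>(\<alpha>, \<beta>) | is_composition \<alpha> \<and> is_composition \<beta> \<and> (\<alpha> @ \<beta> = \<gamma> \<or> \<alpha> \<odot> \<beta> = \<gamma>).
      \<Sum>\<beta>' | \<beta>' \<preceq> \<beta>. tscale (q ^ g_exp \<beta> \<beta>' * d_coeff \<alpha> \<beta> \<beta>' \<gamma>) (G_qsym \<alpha> \<otimes> G_qsym \<beta>'))"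
proof -
  let ?F = "\<lambda>(\<mu>, \<nu>). tscale (hl_weight 0 (comp_set \<gamma>) (comp_set (\<mu> @ \<nu>))) (M_qsym \<mu> \<otimes> M_qsym \<nu>)"
  let ?A = "\<lambda>(\<alpha>, \<beta>). {\<mu>. \<mu> \<preceq> \<alpha>} \<times> {\<nu>. \<nu> \<preceq> \<beta>}"
  have "\<triangle> (G_qsym \<gamma>) = sum ?F (\<Union>x\<in>cuts \<gamma>. ?A x)"
    unfolding coproduct_G_qsym_eq_sum_M_qsym refining_pairs_eq_UN_cuts [OF assms] ..
  also have "\<dots> = (\<Sum>x\<in>cuts \<gamma>. sum ?F (?A x))"
  proof (rule sum.UNION_disjoint)
    show "\<forall>x\<in>cuts \<gamma>. \<forall>y\<in>cuts \<gamma>. x \<noteq> y \<longrightarrow> ?A x \<inter> ?A y = {}"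
    proof (intro ballI impI)
      fix x y assume xy: "x \<in> cuts \<gamma>" "y \<in> cuts \<gamma>" "x \<noteq> y"
      then have "sum_list (fst x) \<noteq> sum_list (fst y)"
        using cut_unique [of "fst x" "snd x" \<gamma> "fst y" "snd y"] by auto
      then show "?A x \<inter> ?A y = {}"
        by (auto simp: refines_def split: prod.splits)
    qed
  qed (auto simp: finite_cuts)
  also have "\<dots> = (\<Sum>(\<alpha>, \<beta>)\<in>cuts \<gamma>. \<Sum>\<beta>' | \<beta>' \<preceq> \<beta>.
      tscale (q ^ g_exp \<beta> \<beta>' * d_coeff \<alpha> \<beta> \<beta>' \<gamma>) (G_qsym \<alpha> \<otimes> G_qsym \<beta>'))"
    by (rule sum.cong [OF refl]) (auto simp: sum_tensor_G_qsym_eq_sum_M_qsym)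
  finally show ?thesis
    by (simp add: cuts_def)
qed

end
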